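(* Let $\mathcal{M}=(U,\mathcal{I})$ be a matroid of rank $k$ with collection of bases $\mathcal{B}$, let $f\colon 2^U\to\mathbb{R}_+$ be a monotone submodular function with multilinear extension $F$, and let $0<\varepsilon\le 1$. Then the process GS-Poisson (described in the context) started at time $\varepsilon$ outputs a set $A\in\mathcal{I}$ satisfying $\mathbb{E}[f(A)]\ge (1-\varepsilon)(1-1/e)\,f(O)$, where $O\in\arg\max\{f(S): S\in\mathcal{I}\}$ is an optimal base.
   Context: A set function $f\colon 2^U\to\mathbb{R}_+$ is submodular if $f(S+i)-f(S)\ge f(T+i)-f(T)$ for all $S\subseteq T\subseteq U$, $i\in U\setminus T$, and monotone if $f(S)\le f(T)$ whenever $S\subseteq T$. The multilinear extension is $F(\mathbf{x})=\sum_{S\subseteq U} f(S)\prod_{i\in S}x_i\prod_{i\notin S}(1-x_i)$ for $\mathbf{x}\in[0,1]^U$; $\nabla_i F(\mathbf{x})$ denotes its partial derivative with respect to $x_i$; $\mathbf{1}_A\in\{0,1\}^U$ is the indicator vector of $A\subseteq U$. GS-Poisson: initialize the internal state $A$ to an arbitrary base of $\mathcal{M}$. Run a non-homogeneous Poisson process with rate $\lambda(t)=k/t$ starting at time $t=\varepsilon$ and stopping at time $t=1$. Whenever an event occurs at a time $t<1$: (1) compute a base $Z(t)\in\mathcal{B}$ maximizing $\sum_{i\in Z(t)}\nabla_i F(t\mathbf{1}_A)$; (2) construct a bijection $h\colon A\to Z(t)$ such that $A-i+h(i)\in\mathcal{B}$ for every $i\in A$; (3) select a uniformly random element $i\in A$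 and set $A\leftarrow A-i+h(i)$. The output is the state $A$ at time $1$. *)

theory Defs
  imports "HOL-Probability.Probability"
begin

section \<open>Matroids\<close>

locale matroid =
  fixes U :: "'a set" and \<I> :: "'a set set"
  assumes finite_ground: "finite U"
    and indep_subset_ground: "\<I> \<subseteq> Pow U"
    and empty_indep: "{} \<in> \<I>"
    and hereditary: "T \<in> \<I> \<Longrightarrow> S \<subseteq> T \<Longrightarrow> S \<in> \<I>"
    and augmentation: "S \<in> \<I> \<Longrightarrow> T \<in> \<I> \<Longrightarrow> card S < card T \<Longrightarrow> \<exists>i\<in>T - S. insert i S \<in> \<I>"

definition matroid_bases :: "'a set set \<Rightarrow> 'a set set" where
  "matroid_bases \<I> = {B \<in> \<I>. \<forall>C\<in>\<I>. B \<subseteq> C \<longrightarrow> C = B}"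

definition matroid_rank :: "'a set set \<Rightarrow> nat" where
  "matroid_rank \<I> = Max (card ` \<I>)"


section \<open>Submodular functions and the multilinear extension\<close>

definition submodular :: "'a set \<Rightarrow> ('a set \<Rightarrow> real) \<Rightarrow> bool" where
  "submodular U f \<longleftrightarrow>
     (\<forall>S T. \<forall>i\<in>U - T. S \<subseteq> T \<and> T \<subseteq> U \<longrightarrow>
        f (insert i S) - f S \<ge> f (insert i T) - f T)"

text \<open>
  The multilinear extension is a polynomial in the coordinates indexed by \<open>U\<close>, so the same
  formula is used on all real vectors. Its partial derivatives at boundary points of the
  unit cube are then ordinary two-sided derivatives.
\<close>

definition multilinear_ext :: "'a set \<Rightarrow> ('a set \<Rightarrow> real) \<Rightarrow> ('a \<Rightarrow> real) \<Rightarrow> real" where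
  "multilinear_ext U f x = (\<Sum>S\<in>Pow U. f S * (\<Prod>i\<in>S. x i) * (\<Prod>i\<in>U - S. 1 - x i))"

definition partial_deriv :: "(('a \<Rightarrow> real) \<Rightarrow> real) \<Rightarrow> 'a \<Rightarrow> ('a \<Rightarrow> real) \<Rightarrow> real" where
  "partial_deriv F i x = deriv (\<lambda>y. F (x(i := y))) (x i)"


section \<open>Non-homogeneous Poisson processes on an interval\<close>

text \<open>
  A process is given by the random finite set \<open>P \<omega>\<close> of its event times. It is a Poisson process
  of rate \<open>r\<close> on \<open>(a, b]\<close> if the numbers of events in consecutive intervals are independent and
  the number in \<open>(s, t]\<close> has the Poisson distribution whose mean is the integral of the rate.
  (The probabilities are written out because \<open>poisson_pmf\<close> is unspecified for mean \<open>0\<close>.)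
\<close>

definition num_events :: "('w \<Rightarrow> real set) \<Rightarrow> real \<Rightarrow> real \<Rightarrow> 'w \<Rightarrow> nat" where
  "num_events P s t \<omega> = card (P \<omega> \<inter> {s<..t})"

definition poisson_process ::
    "'w measure \<Rightarrow> (real \<Rightarrow> real) \<Rightarrow> real \<Rightarrow> real \<Rightarrow> ('w \<Rightarrow> real set) \<Rightarrow> bool" where
  "poisson_process M r a b P \<longleftrightarrow>
     (\<forall>\<omega>\<in>space M. finite (P \<omega>) \<and> P \<omega> \<subseteq> {a<..b}) \<and>
     (\<forall>s t. a \<le> s \<and> s \<le> t \<and> t \<le> b \<longrightarrow>
        num_events P s t \<in> measurable M (count_space UNIV) \<and>
        (\<forall>m. measure M {\<omega> \<in> space M. num_events P s t \<omega> = m} =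
           (LBINT u:{s..t}. r u) ^ m / fact m * exp (- (LBINT u:{s..t}. r u)))) \<and>
     (\<forall>(n::nat) s. (\<forall>j<n. s j \<le> s (Suc j)) \<and> (\<forall>j\<le>n. s j \<in> {a..b}) \<longrightarrow>
        prob_space.indep_vars M (\<lambda>_. count_space UNIV)
          (\<lambda>j. num_events P (s j) (s (Suc j))) {..<n})"

text \<open>
  The events at times \<open>t < b\<close> in increasing order, numbered from \<open>0\<close>; the \<open>n\<close>-th event time
  is set to \<open>b\<close> if there are at most \<open>n\<close> such events.
\<close>

definition events_before :: "real \<Rightarrow> ('w \<Rightarrow> real set) \<Rightarrow> 'w \<Rightarrow> real set" where
  "events_before b P \<omega> = {t \<in> P \<omega>. t < b}"

definition event_time :: "real \<Rightarrow> ('w \<Rightarrow> real set) \<Rightarrow> nat \<Rightarrow> 'w \<Rightarrow> real" where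
  "event_time b P n \<omega> =
     (if n < card (events_before b P \<omega>)
      then sorted_list_of_set (events_before b P \<omega>) ! n else b)"


section \<open>The process GS-Poisson\<close>

text \<open>
  The randomness comes from independent sources. \<open>Clock\<close> is the Poisson process. \<open>Draw n\<close> is the
  selection at the \<open>n\<close>-th event: \<open>X n B\<close> is the element selected if the state is then \<open>B\<close>, and it
  is uniform on \<open>B\<close>. \<open>Ties\<close> is a sigma-algebra \<open>R\<close> of further randomness that may be used for the
  choices the process leaves open (the initial base, the maximizing bases, the bijections);
  it is trivial if these choices are made deterministically.
\<close>

datatype source = Ties | Clock | Draw nat

definition draw_events ::
    "'w measure \<Rightarrow> 'a set set \<Rightarrow> (nat \<Rightarrow> 'a set \<Rightarrow> 'w \<Rightarrow> 'a) \<Rightarrow> nat \<Rightarrow> 'w set set" where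
  "draw_events M \<B> X n = {{\<omega> \<in> space M. X n B \<omega> = i} | B i. B \<in> \<B> \<and> i \<in> B}"

fun source_events ::
    "'w measure \<Rightarrow> 'w measure \<Rightarrow> real \<Rightarrow> ('w \<Rightarrow> real set) \<Rightarrow> 'a set set \<Rightarrow>
     (nat \<Rightarrow> 'a set \<Rightarrow> 'w \<Rightarrow> 'a) \<Rightarrow> source \<Rightarrow> 'w set set" where
  "source_events M R \<epsilon> P \<B> X Ties = sets R"
| "source_events M R \<epsilon> P \<B> X Clock =
     sigma_sets (space M)
       {{\<omega> \<in> space M. num_events P s t \<omega> = m} | s t m. \<epsilon> \<le> s \<and> s \<le> t \<and> t \<le> 1}"
| "source_events M R \<epsilon> P \<B> X (Draw n) = sigma_sets (space M) (draw_events M \<B> X n)"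

text \<open>
  The information available when the process handles its \<open>n\<close>-th event, before it selects an
  element: the tie-breaking randomness, the times of events \<open>0, \<dots>, n\<close>, and the earlier draws.
\<close>

definition history ::
    "'w measure \<Rightarrow> 'w measure \<Rightarrow> ('w \<Rightarrow> real set) \<Rightarrow> 'a set set \<Rightarrow>
     (nat \<Rightarrow> 'a set \<Rightarrow> 'w \<Rightarrow> 'a) \<Rightarrow> nat \<Rightarrow> 'w measure" where
  "history M R P \<B> X n =
     sigma (space M)
       (sets R \<union> {{\<omega> \<in> space M. event_time 1 P m \<omega> \<le> t} | m t. m \<le> n}
          \<union> (\<Union>m<n. draw_events M \<B> X m))"

text \<open>
  State after \<open>n\<close> events, and state at time \<open>1\<close>. The test for the empty state only matters for
  rank \<open>0\<close>, where there is nothing to select and events occur with probability \<open>0\<close>.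
\<close>

fun gs_state ::
    "('w \<Rightarrow> 'a set) \<Rightarrow> (nat \<Rightarrow> 'a set \<Rightarrow> 'w \<Rightarrow> 'a) \<Rightarrow> (nat \<Rightarrow> 'w \<Rightarrow> 'a \<Rightarrow> 'a) \<Rightarrow> nat \<Rightarrow> 'w \<Rightarrow> 'a set" where
  "gs_state A\<^sub>0 X h 0 \<omega> = A\<^sub>0 \<omega>"
| "gs_state A\<^sub>0 X h (Suc n) \<omega> =
     (let A = gs_state A\<^sub>0 X h n \<omega>; i = X n A \<omega>
      in if A = {} then A else insert (h n \<omega> i) (A - {i}))"

definition gs_output ::
    "('w \<Rightarrow> real set) \<Rightarrow> ('w \<Rightarrow> 'a set) \<Rightarrow> (nat \<Rightarrow> 'a set \<Rightarrow> 'w \<Rightarrow> 'a) \<Rightarrow>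
     (nat \<Rightarrow> 'w \<Rightarrow> 'a \<Rightarrow> 'a) \<Rightarrow> 'w \<Rightarrow> 'a set" where
  "gs_output P A\<^sub>0 X h \<omega> = gs_state A\<^sub>0 X h (card (events_before 1 P \<omega>)) \<omega>"

text \<open>
  \<open>Z n \<omega>\<close> and \<open>h n \<omega>\<close> are the base and the bijection computed at the \<open>n\<close>-th event. They may depend
  on the whole history, but not on future events or on the current draw. Their values are
  irrelevant when there is no \<open>n\<close>-th event, and those of \<open>h n \<omega>\<close> are irrelevant outside the
  current state.
\<close>

locale gs_poisson = prob_space M
  for M :: "'w measure" +
  fixes U :: "'a set" and \<I> :: "'a set set" and f :: "'a set \<Rightarrow> real" and \<epsilon> :: real
    and R :: "'w measure" and P :: "'w \<Rightarrow> real set" and X :: "nat \<Rightarrow> 'a set \<Rightarrow> 'w \<Rightarrow> 'a"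
    and A\<^sub>0 :: "'w \<Rightarrow> 'a set" and Z :: "nat \<Rightarrow> 'w \<Rightarrow> 'a set" and h :: "nat \<Rightarrow> 'w \<Rightarrow> 'a \<Rightarrow> 'a"
  assumes poisson: "poisson_process M (\<lambda>t. real (matroid_rank \<I>) / t) \<epsilon> 1 P"
    and ties: "subalgebra M R"
    and draw_in: "\<And>n B \<omega>. B \<in> matroid_bases \<I> \<Longrightarrow> B \<noteq> {} \<Longrightarrow> \<omega> \<in> space M \<Longrightarrow> X n B \<omega> \<in> B"
    and draw_uniform: "\<And>n B i. B \<in> matroid_bases \<I> \<Longrightarrow> i \<in> B \<Longrightarrow>
      prob {\<omega> \<in> space M. X n B \<omega> = i} = 1 / card B"
    and indep_sources: "indep_sets (source_events M R \<epsilon> P (matroid_bases \<I>) X) UNIV"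
    and init_measurable: "A\<^sub>0 \<in> measurable R (count_space UNIV)"
    and init_base: "\<And>\<omega>. \<omega> \<in> space M \<Longrightarrow> A\<^sub>0 \<omega> \<in> matroid_bases \<I>"
    and base_measurable: "\<And>n. Z n \<in>
      measurable (history M R P (matroid_bases \<I>) X n) (count_space UNIV)"
    and bij_measurable: "\<And>n i. i \<in> U \<Longrightarrow> (\<lambda>\<omega>. h n \<omega> i) \<in>
      measurable (history M R P (matroid_bases \<I>) X n) (count_space UNIV)"
    and base_maximizes: "\<And>n \<omega>. \<omega> \<in> space M \<Longrightarrow> n < card (events_before 1 P \<omega>) \<Longrightarrow>
      is_arg_max
        (\<lambda>B. \<Sum>i\<in>B. partial_deriv (multilinear_ext U f) i
           (\<lambda>j. event_time 1 P n \<omega> * indicator (gs_state A\<^sub>0 X h n \<omega>) j))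
        (\<lambda>B. B \<in> matroid_bases \<I>) (Z n \<omega>)"
    and bij: "\<And>n \<omega>. \<omega> \<in> space M \<Longrightarrow> n < card (events_before 1 P \<omega>) \<Longrightarrow>
      bij_betw (h n \<omega>) (gs_state A\<^sub>0 X h n \<omega>) (Z n \<omega>)"
    and exchange: "\<And>n \<omega> i. \<omega> \<in> space M \<Longrightarrow> n < card (events_before 1 P \<omega>) \<Longrightarrow>
      i \<in> gs_state A\<^sub>0 X h n \<omega> \<Longrightarrow>
      insert (h n \<omega> i) (gs_state A\<^sub>0 X h n \<omega> - {i}) \<in> matroid_bases \<I>"

end

(*
  Let A(t) be the state at time t and g(t) = E[F(t 1_A(t))]. Between events F(t 1_A) grows at rate
  sum_(i in A) dF/dx_i. An event at time t replaces a uniformly random i in A by h(i), which by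
  submodularity gains on average at least t/k * (sum_(j in Z) dF/dx_j - sum_(i in A) dF/dx_i);
  events come at rate k/t, so the two sums over A cancel. Since Z is a maximizing base,
  sum_(j in Z) dF/dx_j >= f(V) - F(t 1_A) for every base V. Hence g' >= f(V) - g, which gives
  g(1) >= (1 - exp(-(1 - eps))) f(V) >= (1 - eps)(1 - 1/e) f(V).

  The differential inequality is used in the form
    g(t) - g(s) >= (t - s) (f(V) - g(s)) - C (t - s)^2   for eps <= s <= t < 1,
  obtained by distinguishing no event, one event and several events in (s, t]; summing over ever
  finer partitions removes the error term.
*)
theory Submission
  imports Defs
begin

text \<open>Two independences carry the probabilistic part. \<open>Draw n\<close> is indexed by the
  number of the event and not by its time, so it is independent of the entire clock together with
  the ties and the earlier draws; and the clock after \<open>s\<close> is independent of everything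
  known at \<open>s\<close>. The obstacle is that \<open>Z n\<close> and \<open>h n\<close> are
  chosen at a random time and may depend on it, hence on the clock in \<open>(s, t]\<close>. The
  proof therefore never conditions on the event time. It fixes the count \<open>n\<close> and the
  base \<open>B\<close> at time \<open>s\<close>, bounds the sum over \<open>i\<close> in
  \<open>B\<close> of the values after the exchange for each single outcome (the bound is monotone
  in the event time, so endpoints suffice), and only then averages over the draw. All estimates are
  made at times below 1 and the output is reached as a limit, because the clock also counts an event
  at time exactly 1, which the process does not handle. The final factor (1 - eps)(1 - 1/e) comes
  from comparing the concave function 1 - exp(-x) with its chord on [0, 1].\<close>

section \<open>The multilinear extension\<close>

text \<open>Conditions the random set on whether it contains \<open>i\<close>. This recursion drives
  the inductions on \<open>U\<close> below; those for general \<open>f\<close> keep \<open>f\<close>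
  arbitrary because the second summand belongs to another set function.\<close>

lemma multilinear_ext_insert:
  assumes "finite U" "i \<notin> U"
  shows "multilinear_ext (insert i U) f x =
    (1 - x i) * multilinear_ext U f x + x i * multilinear_ext U (\<lambda>S. f (insert i S)) x"
proof -
  let ?w = "\<lambda>V S. f S * (\<Prod>j\<in>S. x j) * (\<Prod>j\<in>V - S. 1 - x j)"
  have inj: "inj_on (insert i) (Pow U)"
    using assms(2) by (auto simp: inj_on_def)
  have "multilinear_ext (insert i U) f x =
      sum (?w (insert i U)) (Pow U) + sum (?w (insert i U)) (insert i ` Pow U)"
    unfolding multilinear_ext_def Pow_insert
    using assms by (intro sum.union_disjoint) auto
  also have "sum (?w (insert i U)) (Pow U) = (1 - x i) * multilinear_ext U f x"
    unfolding multilinear_ext_def sum_distrib_left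
  proof (rule sum.cong)
    fix S assume "S \<in> Pow U"
    then have "insert i U - S = insert i (U - S)" "i \<notin> U - S" "finite (U - S)"
      using assms by auto
    then show "?w (insert i U) S = (1 - x i) * ?w U S" by simp
  qed simp
  also have "sum (?w (insert i U)) (insert i ` Pow U) =
      x i * multilinear_ext U (\<lambda>S. f (insert i S)) x"
    unfolding multilinear_ext_def sum_distrib_left sum.reindex[OF inj]
  proof (rule sum.cong)
    fix S assume "S \<in> Pow U"
    then have "insert i U - insert i S = U - S" "i \<notin> S" "finite S"
      using assms finite_subset by auto
    then show "(?w (insert i U) \<circ> insert i) S =
        x i * (f (insert i S) * (\<Prod>j\<in>S. x j) * (\<Prod>j\<in>U - S. 1 - x j))" by simp
  qed simp
  finally show ?thesis .
qed

lemma multilinear_ext_empty [simp]: "multilinear_ext {} f x = f {}"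
  by (simp add: multilinear_ext_def)

lemma multilinear_ext_cong:
  assumes "\<And>i. i \<in> U \<Longrightarrow> x i = y i"
  shows "multilinear_ext U f x = multilinear_ext U f y"
  unfolding multilinear_ext_def
proof (rule sum.cong)
  fix S assume "S \<in> Pow U"
  then have "(\<Prod>i\<in>S. x i) = (\<Prod>i\<in>S. y i)" using assms by (intro prod.cong) auto
  moreover have "(\<Prod>i\<in>U - S. 1 - x i) = (\<Prod>i\<in>U - S. 1 - y i)"
    using assms by (intro prod.cong) auto
  ultimately show "f S * (\<Prod>i\<in>S. x i) * (\<Prod>i\<in>U - S. 1 - x i) =
      f S * (\<Prod>i\<in>S. y i) * (\<Prod>i\<in>U - S. 1 - y i)" by simp
qed simp

lemma multilinear_ext_diff:
  "multilinear_ext U (\<lambda>S. f S - g S) x = multilinear_ext U f x - multilinear_ext U g x"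
  by (simp add: multilinear_ext_def left_diff_distrib sum_subtractf)

lemma multilinear_ext_uminus: "multilinear_ext U (\<lambda>S. - f S) x = - multilinear_ext U f x"
  by (simp add: multilinear_ext_def sum_negf)

lemma multilinear_ext_const:
  assumes "finite U"
  shows "multilinear_ext U (\<lambda>_. c) x = c"
  using assms by (induction U rule: finite_induct)
    (simp_all add: multilinear_ext_insert algebra_simps)

lemma multilinear_ext_indicator:
  assumes "finite U" "A \<subseteq> U"
  shows "multilinear_ext U f (indicator A) = f A"
  using assms
proof (induction U arbitrary: A f rule: finite_induct)
  case (insert i U)
  have "multilinear_ext U g (indicator A) = g (A - {i})" for g
  proof -
    have "multilinear_ext U g (indicator A) = multilinear_ext U g (indicator (A - {i}))"
      using insert.hyps by (intro multilinear_ext_cong) (auto simp: indicator_def)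
    also have "\<dots> = g (A - {i})"
      using insert.prems by (intro insert.IH) auto
    finally show ?thesis .
  qed
  then show ?case
    using insert.hyps by (cases "i \<in> A") (simp_all add: multilinear_ext_insert insert_absorb)
qed simp

lemma multilinear_ext_mono_fun:
  assumes "finite U" "\<And>S. S \<subseteq> U \<Longrightarrow> f S \<le> g S" "\<And>i. i \<in> U \<Longrightarrow> 0 \<le> x i \<and> x i \<le> 1"
  shows "multilinear_ext U f x \<le> multilinear_ext U g x"
  unfolding multilinear_ext_def using assms
  by (intro sum_mono mult_right_mono prod_nonneg) (auto simp: subset_iff)

lemma multilinear_ext_mono:
  assumes "finite U" "mono_on (Pow U) f" "\<And>i. i \<in> U \<Longrightarrow> 0 \<le> x i \<and> x i \<le> y i \<and> y i \<le> 1"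
  shows "multilinear_ext U f x \<le> multilinear_ext U f y"
  using assms
proof (induction U arbitrary: f rule: finite_induct)
  case (insert i U)
  let ?g = "\<lambda>S. f (insert i S)"
  have xy: "0 \<le> x i" "x i \<le> y i" "y i \<le> 1" using insert.prems(2)[of i] by auto
  have "multilinear_ext U f x \<le> multilinear_ext U f y"
    using insert.prems by (intro insert.IH mono_on_subset[OF insert.prems(1)]) auto
  moreover have "multilinear_ext U ?g x \<le> multilinear_ext U ?g y"
  proof (rule insert.IH)
    show "mono_on (Pow U) ?g"
      by (intro mono_onI mono_onD[OF insert.prems(1)]) auto
  qed (use insert.prems(2) in auto)
  ultimately have "multilinear_ext (insert i U) f x \<le>
      (1 - x i) * multilinear_ext U f y + x i * multilinear_ext U ?g y"
    using insert.hyps xy by (auto simp: multilinear_ext_insert intro!: add_mono mult_left_mono)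
  \<comment> \<open>Written as an affine function of \<open>x i\<close>, whose coefficient is
    nonnegative because \<open>f S\<close> is at most \<open>f (insert i S)\<close>; so
    \<open>x i\<close> may be raised to \<open>y i\<close>.\<close>
  also have "\<dots> = multilinear_ext U f y +
      x i * (multilinear_ext U ?g y - multilinear_ext U f y)"
    by (simp add: algebra_simps)
  also have "\<dots> \<le> multilinear_ext U f y +
      y i * (multilinear_ext U ?g y - multilinear_ext U f y)"
  proof -
    have "multilinear_ext U f y \<le> multilinear_ext U ?g y"
    proof (rule multilinear_ext_mono_fun)
      show "\<And>j. j \<in> U \<Longrightarrow> 0 \<le> y j \<and> y j \<le> 1"
        using insert.prems(2) by (meson insertCI order_trans)
      show "\<And>S. S \<subseteq> U \<Longrightarrow> f S \<le> f (insert i S)"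
        using insert.prems(1) by (auto intro!: mono_onD[of _ f])
    qed (use insert.hyps in auto)
    then show ?thesis using xy by (auto intro!: mult_right_mono)
  qed
  also have "\<dots> = multilinear_ext (insert i U) f y"
    using insert.hyps by (simp add: multilinear_ext_insert algebra_simps)
  finally show ?case .
qed simp

lemma multilinear_ext_bounds:
  assumes "finite U" "\<And>S. S \<subseteq> U \<Longrightarrow> a \<le> f S \<and> f S \<le> b" "\<And>i. i \<in> U \<Longrightarrow> 0 \<le> x i \<and> x i \<le> 1"
  shows "a \<le> multilinear_ext U f x" "multilinear_ext U f x \<le> b"
  using multilinear_ext_mono_fun[of U "\<lambda>_. a" f x] multilinear_ext_mono_fun[of U f "\<lambda>_. b" x] assms
  by (auto simp: multilinear_ext_const)

text \<open>Each coordinate contributes at most \<open>C * d\<close>: the extension is affine in it,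
  with a slope that is the difference of two values in \<open>[0, C]\<close>.\<close>

lemma multilinear_ext_lipschitz:
  assumes "finite U" "\<And>S. S \<subseteq> U \<Longrightarrow> 0 \<le> f S \<and> f S \<le> C"
    and "\<And>i. i \<in> U \<Longrightarrow> 0 \<le> x i \<and> x i \<le> 1" "\<And>i. i \<in> U \<Longrightarrow> 0 \<le> y i \<and> y i \<le> 1"
    and "\<And>i. i \<in> U \<Longrightarrow> \<bar>x i - y i\<bar> \<le> d" "0 \<le> d"
  shows "\<bar>multilinear_ext U f x - multilinear_ext U f y\<bar> \<le> C * card U * d"
  using assms
proof (induction U arbitrary: f rule: finite_induct)
  case (insert i U)
  let ?g = "\<lambda>S. f (insert i S)"
  let ?a = "multilinear_ext U f" and ?b = "multilinear_ext U ?g"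
  have xi: "0 \<le> x i" "x i \<le> 1" "\<bar>x i - y i\<bar> \<le> d" using insert.prems(2,4)[of i] by auto
  have f: "0 \<le> f S \<and> f S \<le> C" "0 \<le> ?g S \<and> ?g S \<le> C" if "S \<subseteq> U" for S
    using that by (auto intro!: insert.prems(1)[of S] insert.prems(1)[of "insert i S"])
  have a: "\<bar>?a x - ?a y\<bar> \<le> C * card U * d"
    using insert.prems(2-) f(1) by (intro insert.IH) auto
  have b: "\<bar>?b x - ?b y\<bar> \<le> C * card U * d"
    using insert.prems(2-) f(2) by (intro insert.IH) auto
  have y: "0 \<le> y j \<and> y j \<le> 1" if "j \<in> U" for j
    using insert.prems(3) that by auto
  have "0 \<le> ?a y" "?a y \<le> C" "0 \<le> ?b y" "?b y \<le> C"
    using multilinear_ext_bounds[OF insert.hyps(1) f(1) y] multilinear_ext_bounds[OF insert.hyps(1) f(2) y]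
    by auto
  then have "\<bar>?b y - ?a y\<bar> \<le> C" by auto
  then have "\<bar>(x i - y i) * (?b y - ?a y)\<bar> \<le> d * C"
    unfolding abs_mult using xi by (intro mult_mono) auto
  moreover have "\<bar>(1 - x i) * (?a x - ?a y)\<bar> \<le> (1 - x i) * (C * card U * d)"
    unfolding abs_mult using xi a by (auto intro!: mult_left_mono)
  moreover have "\<bar>x i * (?b x - ?b y)\<bar> \<le> x i * (C * card U * d)"
    unfolding abs_mult using xi b by (auto intro!: mult_left_mono)
  moreover have "multilinear_ext (insert i U) f x - multilinear_ext (insert i U) f y =
      (1 - x i) * (?a x - ?a y) + x i * (?b x - ?b y) + (x i - y i) * (?b y - ?a y)"
    using insert.hyps by (simp add: multilinear_ext_insert algebra_simps)
  moreover have "(1 - x i) * (C * card U * d) + x i * (C * card U * d) + d * C =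
      C * card (insert i U) * d"
    using insert.hyps by (simp add: algebra_simps)
  ultimately show ?case by linarith
qed simp

text \<open>This is the partial derivative with respect to \<open>x i\<close>. Written as the
  multilinear extension of the marginal gain on \<open>U - {i}\<close>, it visibly does not depend
  on \<open>x i\<close>, and the bounds for \<open>multilinear_ext\<close> apply to it.\<close>

definition marginal_ext :: "'a set \<Rightarrow> ('a set \<Rightarrow> real) \<Rightarrow> 'a \<Rightarrow> ('a \<Rightarrow> real) \<Rightarrow> real" where
  "marginal_ext U f i x = multilinear_ext (U - {i}) (\<lambda>S. f (insert i S) - f S) x"

lemma marginal_ext_upd [simp]: "marginal_ext U f i (x(i := y)) = marginal_ext U f i x"
  unfolding marginal_ext_def by (rule multilinear_ext_cong) auto

text \<open>Exact for every real \<open>y\<close>, without remainder, since the extension is affine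
  in each coordinate.\<close>

lemma multilinear_ext_upd:
  assumes "finite U" "i \<in> U"
  shows "multilinear_ext U f (x(i := y)) = multilinear_ext U f x + (y - x i) * marginal_ext U f i x"
proof -
  have U: "U = insert i (U - {i})" "i \<notin> U - {i}" "finite (U - {i})" using assms by auto
  have *: "multilinear_ext U f z = multilinear_ext (U - {i}) f z + z i * marginal_ext U f i z" for z
    by (subst U(1), subst multilinear_ext_insert[OF U(3,2)])
       (simp add: marginal_ext_def multilinear_ext_diff algebra_simps)
  have "multilinear_ext (U - {i}) f (x(i := y)) = multilinear_ext (U - {i}) f x"
    by (rule multilinear_ext_cong) auto
  then show ?thesis by (simp add: *[of x] *[of "x(i := y)"] algebra_simps)
qed

lemma partial_deriv_multilinear_ext:
  assumes "finite U" "i \<in> U"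
  shows "partial_deriv (multilinear_ext U f) i x = marginal_ext U f i x"
  unfolding partial_deriv_def multilinear_ext_upd[OF assms]
  by (rule DERIV_imp_deriv) (auto intro!: derivative_eq_intros)

text \<open>Submodularity makes the marginal gain an antitone set function; its negation is
  monotone, so \<open>multilinear_ext_mono\<close> applies.\<close>

lemma marginal_ext_antimono:
  assumes "finite U" "submodular U f" "i \<in> U"
    "\<And>j. j \<in> U \<Longrightarrow> 0 \<le> x j \<and> x j \<le> y j \<and> y j \<le> 1"
  shows "marginal_ext U f i y \<le> marginal_ext U f i x"
proof -
  have "multilinear_ext (U - {i}) (\<lambda>S. - (f (insert i S) - f S)) x \<le>
      multilinear_ext (U - {i}) (\<lambda>S. - (f (insert i S) - f S)) y"
  proof (rule multilinear_ext_mono)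
    show "mono_on (Pow (U - {i})) (\<lambda>S. - (f (insert i S) - f S))"
    proof (rule mono_onI)
      fix S T assume "S \<in> Pow (U - {i})" "T \<in> Pow (U - {i})" "S \<subseteq> T"
      then have "S \<subseteq> T" "T \<subseteq> U" "i \<in> U - T" using assms(3) by auto
      then have "f (insert i S) - f S \<ge> f (insert i T) - f T"
        using assms(2) unfolding submodular_def by blast
      then show "- (f (insert i S) - f S) \<le> - (f (insert i T) - f T)" by simp
    qed
  qed (use assms in auto)
  then show ?thesis unfolding multilinear_ext_uminus marginal_ext_def by simp
qed

lemma marginal_bounds:
  fixes f :: "'a set \<Rightarrow> real"
  assumes "\<forall>S\<subseteq>U. 0 \<le> f S" "mono_on (Pow U) f" "i \<in> U" "S \<subseteq> U - {i}"
  shows "0 \<le> f (insert i S) - f S \<and> f (insert i S) - f S \<le> f U"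
proof -
  have S: "insert i S \<subseteq> U" "S \<subseteq> U" using assms by auto
  have "f S \<le> f (insert i S)" "f (insert i S) \<le> f U" "0 \<le> f S"
    using S assms(1) by (auto intro!: mono_onD[OF assms(2)])
  then show ?thesis by auto
qed

lemma marginal_ext_bounds:
  assumes "finite U" "\<forall>S\<subseteq>U. 0 \<le> f S" "mono_on (Pow U) f" "i \<in> U"
    "\<And>j. j \<in> U \<Longrightarrow> 0 \<le> x j \<and> x j \<le> 1"
  shows "0 \<le> marginal_ext U f i x" "marginal_ext U f i x \<le> f U"
proof -
  have *: "0 \<le> multilinear_ext (U - {i}) (\<lambda>S. f (insert i S) - f S) x"
    "multilinear_ext (U - {i}) (\<lambda>S. f (insert i S) - f S) x \<le> f U"
    using multilinear_ext_bounds[of "U - {i}" 0 "\<lambda>S. f (insert i S) - f S" "f U" x]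
      marginal_bounds[OF assms(2-4)] assms(1,5)
    by simp_all
  show "0 \<le> marginal_ext U f i x" "marginal_ext U f i x \<le> f U"
    unfolding marginal_ext_def using assms(1,5) * by auto
qed

lemma marginal_ext_lipschitz:
  assumes "finite U" "\<forall>S\<subseteq>U. 0 \<le> f S" "mono_on (Pow U) f" "i \<in> U"
    "\<And>j. j \<in> U \<Longrightarrow> 0 \<le> x j \<and> x j \<le> 1" "\<And>j. j \<in> U \<Longrightarrow> 0 \<le> y j \<and> y j \<le> 1"
    and "\<And>j. j \<in> U \<Longrightarrow> \<bar>x j - y j\<bar> \<le> d" "0 \<le> d"
  shows "marginal_ext U f i x - marginal_ext U f i y \<le> f U * card U * d"
proof -
  have "marginal_ext U f i x - marginal_ext U f i y \<le> f U * card (U - {i}) * d"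
    unfolding marginal_ext_def using assms marginal_bounds[OF assms(2-4)]
    by (intro order_trans[OF abs_ge_self multilinear_ext_lipschitz]) auto
  also have "\<dots> \<le> f U * card U * d"
    using assms by (intro mult_right_mono mult_left_mono) (auto intro: card_mono)
  finally show ?thesis .
qed

text \<open>Coordinates are moved from \<open>x\<close> to \<open>y\<close> one at a time. Each
  change is exact, with the marginal taken at a mixed point, where by antitonicity it lies between
  the marginals at \<open>y\<close> and at \<open>x\<close>.\<close>

lemma multilinear_ext_increment:
  assumes "finite U" "submodular U f" "\<And>j. j \<in> U \<Longrightarrow> 0 \<le> x j \<and> x j \<le> y j \<and> y j \<le> 1"
  shows "(\<Sum>i\<in>U. (y i - x i) * marginal_ext U f i y) \<le> multilinear_ext U f y - multilinear_ext U f x"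
    and "multilinear_ext U f y - multilinear_ext U f x \<le> (\<Sum>i\<in>U. (y i - x i) * marginal_ext U f i x)"
proof -
  define z where "z T = (\<lambda>i. if i \<in> T then y i else x i)" for T
  have "(\<Sum>i\<in>T. (y i - x i) * marginal_ext U f i y) \<le> multilinear_ext U f (z T) - multilinear_ext U f x
      \<and> multilinear_ext U f (z T) - multilinear_ext U f x \<le> (\<Sum>i\<in>T. (y i - x i) * marginal_ext U f i x)"
    if "finite T" "T \<subseteq> U" for T
    using that
  proof (induction T rule: finite_induct)
    case empty
    then show ?case by (simp add: z_def)
  next
    case (insert i T)
    then have i: "i \<in> U" by auto
    have "z (insert i T) = (z T)(i := y i)" by (auto simp: z_def)
    then have "multilinear_ext U f (z (insert i T)) - multilinear_ext U f (z T) =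
        (y i - x i) * marginal_ext U f i (z T)"
      using insert.hyps by (simp add: multilinear_ext_upd[OF assms(1) i] z_def)
    moreover have "marginal_ext U f i y \<le> marginal_ext U f i (z T)"
      "marginal_ext U f i (z T) \<le> marginal_ext U f i x"
      using assms i by (intro marginal_ext_antimono; force simp: z_def)+
    then have "(y i - x i) * marginal_ext U f i y \<le> (y i - x i) * marginal_ext U f i (z T)"
      "(y i - x i) * marginal_ext U f i (z T) \<le> (y i - x i) * marginal_ext U f i x"
      using assms(3)[OF i] by (auto intro!: mult_left_mono)
    ultimately show ?case using insert by auto
  qed
  from this[OF assms(1) order_refl]
  have "(\<Sum>i\<in>U. (y i - x i) * marginal_ext U f i y) \<le> multilinear_ext U f (z U) - multilinear_ext U f x
      \<and> multilinear_ext U f (z U) - multilinear_ext U f x \<le> (\<Sum>i\<in>U. (y i - x i) * marginal_ext U f i x)" .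
  moreover have "multilinear_ext U f (z U) = multilinear_ext U f y"
    by (rule multilinear_ext_cong) (simp add: z_def)
  ultimately show "(\<Sum>i\<in>U. (y i - x i) * marginal_ext U f i y) \<le> multilinear_ext U f y - multilinear_ext U f x"
    "multilinear_ext U f y - multilinear_ext U f x \<le> (\<Sum>i\<in>U. (y i - x i) * marginal_ext U f i x)"
    by auto
qed

text \<open>Raising the coordinates in \<open>V\<close> to 1 brings the value to at least
  \<open>f V\<close>, and \<open>multilinear_ext_increment\<close> bounds that increase by the
  marginals at \<open>x\<close>. The factors \<open>1 - x i\<close> are then dropped, as the
  marginals are nonnegative.\<close>

lemma sum_marginal_ext_ge:
  assumes "finite U" "mono_on (Pow U) f" "\<forall>S\<subseteq>U. 0 \<le> f S" "submodular U f"
    and "V \<subseteq> U" "\<And>j. j \<in> U \<Longrightarrow> 0 \<le> x j \<and> x j \<le> 1"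
  shows "f V - multilinear_ext U f x \<le> (\<Sum>i\<in>V. marginal_ext U f i x)"
proof -
  define y where "y i = (if i \<in> V then 1 else x i)" for i
  have "f V = multilinear_ext U f (indicator V)"
    using assms by (simp add: multilinear_ext_indicator)
  also have "\<dots> \<le> multilinear_ext U f y"
    using assms by (intro multilinear_ext_mono) (auto simp: y_def indicator_def)
  finally have "f V - multilinear_ext U f x \<le> multilinear_ext U f y - multilinear_ext U f x" by simp
  also have "\<dots> \<le> (\<Sum>i\<in>U. (y i - x i) * marginal_ext U f i x)"
    using assms by (intro multilinear_ext_increment) (auto simp: y_def)
  also have "\<dots> = (\<Sum>i\<in>V. (1 - x i) * marginal_ext U f i x)"
    using assms by (intro sum.mono_neutral_cong_right) (auto simp: y_def)
  also have "\<dots> \<le> (\<Sum>i\<in>V. marginal_ext U f i x)"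
  proof (rule sum_mono)
    fix i assume "i \<in> V"
    then have "i \<in> U" using assms by auto
    then show "(1 - x i) * marginal_ext U f i x \<le> marginal_ext U f i x"
      using assms(6)[of i] marginal_ext_bounds(1)[OF assms(1,3,2) \<open>i \<in> U\<close> assms(6)]
      by (intro mult_left_le_one_le) auto
  qed
  finally show ?thesis .
qed

text \<open>The exchange is made in two exact moves, coordinate \<open>i\<close> down to 0 and then
  \<open>j\<close> up to \<tau>. At the intermediate point one coordinate is lower, so the marginal
  of \<open>j\<close> is at least that at \<open>x B\<close>. The condition on \<open>j\<close>
  ensures that, unless \<open>j = i\<close>, its coordinate starts at 0.\<close>

lemma multilinear_ext_exchange:
  assumes "finite U" "submodular U f" "B \<subseteq> U" "i \<in> B" "j \<in> U" "j \<notin> B - {i}" "0 \<le> \<tau>" "\<tau> \<le> 1"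
  defines "x \<equiv> \<lambda>A l. \<tau> * indicator A l"
  shows "multilinear_ext U f (x (insert j (B - {i}))) \<ge>
    multilinear_ext U f (x B) + \<tau> * (marginal_ext U f j (x B) - marginal_ext U f i (x B))"
proof (cases "j = i")
  case True
  then show ?thesis using assms(4) by (simp add: insert_absorb)
next
  case False
  then have jB: "j \<notin> B" using assms by auto
  have iU: "i \<in> U" using assms by auto
  let ?y = "(x B)(i := 0)"
  have "x (insert j (B - {i})) = ?y(j := \<tau>)"
    using jB False by (auto simp: x_def indicator_def)
  moreover have "?y j = 0" using jB by (simp add: x_def)
  ultimately have "multilinear_ext U f (x (insert j (B - {i}))) =
      multilinear_ext U f ?y + \<tau> * marginal_ext U f j ?y"
    by (simp add: multilinear_ext_upd[OF assms(1,5)])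
  also have "multilinear_ext U f ?y = multilinear_ext U f (x B) - \<tau> * marginal_ext U f i (x B)"
    using assms(4) by (simp add: multilinear_ext_upd[OF assms(1) iU] x_def)
  finally have "multilinear_ext U f (x (insert j (B - {i}))) =
      multilinear_ext U f (x B) - \<tau> * marginal_ext U f i (x B) + \<tau> * marginal_ext U f j ?y" .
  moreover have "\<tau> * marginal_ext U f j (x B) \<le> \<tau> * marginal_ext U f j ?y"
    using assms by (intro mult_left_mono marginal_ext_antimono) (auto simp: x_def indicator_def)
  ultimately show ?thesis by (simp add: algebra_simps)
qed

section \<open>Rays through indicator vectors\<close>

definition ray :: "'a set \<Rightarrow> ('a set \<Rightarrow> real) \<Rightarrow> 'a set \<Rightarrow> real \<Rightarrow> real" where
  "ray U f B t = multilinear_ext U f (\<lambda>i. t * indicator B i)"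

text \<open>By the chain rule this is the derivative of \<open>ray U f B\<close> at
  \<open>t\<close>. Only finite increments are compared with it, so no derivative along the ray is
  ever taken.\<close>

definition ray_slope :: "'a set \<Rightarrow> ('a set \<Rightarrow> real) \<Rightarrow> 'a set \<Rightarrow> real \<Rightarrow> real" where
  "ray_slope U f B t = (\<Sum>i\<in>B. marginal_ext U f i (\<lambda>j. t * indicator B j))"

locale monotone_submodular =
  fixes U :: "'a set" and f :: "'a set \<Rightarrow> real"
  assumes finite_U: "finite U"
    and nonneg: "\<forall>S\<subseteq>U. 0 \<le> f S"
    and mono: "mono_on (Pow U) f"
    and submod: "submodular U f"
begin

lemma le_top: "S \<subseteq> U \<Longrightarrow> f S \<le> f U"
  by (intro mono_onD[OF mono]) auto

lemma top_nonneg: "0 \<le> f U"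
  using nonneg by auto

lemma ray_bounds:
  assumes "0 \<le> t" "t \<le> 1"
  shows "0 \<le> ray U f B t" "ray U f B t \<le> f U"
  unfolding ray_def using assms nonneg le_top finite_U
  by (auto intro!: multilinear_ext_bounds simp: indicator_def)

lemma ray_one: "B \<subseteq> U \<Longrightarrow> ray U f B 1 = f B"
  using multilinear_ext_indicator[OF finite_U, of B f] by (simp add: ray_def)

lemma ray_mono:
  assumes "0 \<le> s" "s \<le> t" "t \<le> 1"
  shows "ray U f B s \<le> ray U f B t"
  unfolding ray_def using assms finite_U mono
  by (intro multilinear_ext_mono) (auto simp: indicator_def)

lemma ray_slope_antimono:
  assumes "B \<subseteq> U" "0 \<le> s" "s \<le> t" "t \<le> 1"
  shows "ray_slope U f B t \<le> ray_slope U f B s"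
  unfolding ray_slope_def using assms finite_U submod
  by (intro sum_mono marginal_ext_antimono) (auto simp: indicator_def)

lemma ray_slope_bounds:
  assumes "B \<subseteq> U" "0 \<le> t" "t \<le> 1"
  shows "0 \<le> ray_slope U f B t" "ray_slope U f B t \<le> card B * f U"
proof -
  have *: "0 \<le> marginal_ext U f i (\<lambda>j. t * indicator B j)"
    "marginal_ext U f i (\<lambda>j. t * indicator B j) \<le> f U" if "i \<in> B" for i
    using marginal_ext_bounds[OF finite_U nonneg mono, of i "\<lambda>j. t * indicator B j"] that assms
    by (auto simp: indicator_def)
  then show "0 \<le> ray_slope U f B t" "ray_slope U f B t \<le> card B * f U"
    unfolding ray_slope_def by (auto intro!: sum_nonneg sum_bounded_above)
qed

lemma ray_slope_lipschitz:
  assumes "B \<subseteq> U" "0 \<le> s" "s \<le> t" "t \<le> 1"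
  shows "ray_slope U f B s - ray_slope U f B t \<le> card B * (f U * card U * (t - s))"
  unfolding ray_slope_def sum_subtractf[symmetric] using assms
  by (intro sum_bounded_above marginal_ext_lipschitz finite_U nonneg mono) (auto simp: indicator_def)

text \<open>Along a ray the function is concave, so the slope at the right end bounds the increment
  from below.\<close>

lemma ray_increment:
  assumes "B \<subseteq> U" "0 \<le> s" "s \<le> t" "t \<le> 1"
  shows "(t - s) * ray_slope U f B t \<le> ray U f B t - ray U f B s"
proof -
  have "(t - s) * ray_slope U f B t =
      (\<Sum>i\<in>U. (t * indicator B i - s * indicator B i) * marginal_ext U f i (\<lambda>j. t * indicator B j))"
    unfolding ray_slope_def sum_distrib_left using assms finite_U
    by (intro sum.mono_neutral_cong_left) auto
  also have "\<dots> \<le> ray U f B t - ray U f B s"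
    unfolding ray_def using assms
    by (intro multilinear_ext_increment finite_U submod) (auto simp: indicator_def)
  finally show ?thesis .
qed

text \<open>The slope is moved to the left end, at second-order cost, because the loss at an event
  is also expressed by the slope at \<open>s\<close> and the two have to cancel.\<close>

lemma ray_increment':
  assumes "B \<subseteq> U" "0 \<le> s" "s \<le> t" "t \<le> 1"
  shows "(t - s) * ray_slope U f B s - card B * f U * card U * (t - s)\<^sup>2 \<le> ray U f B t - ray U f B s"
proof -
  have "(t - s) * (ray_slope U f B s - card B * (f U * card U * (t - s))) \<le> (t - s) * ray_slope U f B t"
    using ray_slope_lipschitz[OF assms] assms by (intro mult_left_mono) auto
  then show ?thesis
    using ray_increment[OF assms] by (simp add: algebra_simps power2_eq_square)
qed

text \<open>Summation of \<open>multilinear_ext_exchange\<close> over \<open>B\<close>. The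
  bijection turns the sum of the incoming marginals into the sum over \<open>Z\<close>, hence at
  least that over \<open>V\<close>, hence at least \<open>f V - ray U f B \<tau>\<close>; the
  outgoing marginals add up to \<open>ray_slope\<close>.\<close>

lemma sum_ray_exchange:
  fixes \<tau> :: real
  assumes B: "B \<subseteq> U" and Z: "Z \<subseteq> U" "bij_betw h B Z" "\<And>i. i \<in> B \<Longrightarrow> h i \<notin> B - {i}"
    and V: "V \<subseteq> U"
    and max: "(\<Sum>i\<in>V. marginal_ext U f i (\<lambda>j. \<tau> * indicator B j)) \<le>
      (\<Sum>i\<in>Z. marginal_ext U f i (\<lambda>j. \<tau> * indicator B j))"
    and \<tau>: "0 \<le> \<tau>" "\<tau> \<le> 1"
  shows "(card B - \<tau>) * ray U f B \<tau> + \<tau> * f V - \<tau> * ray_slope U f B \<tau> \<le>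
    (\<Sum>i\<in>B. ray U f (insert (h i) (B - {i})) \<tau>)"
proof -
  let ?m = "\<lambda>i. marginal_ext U f i (\<lambda>j. \<tau> * indicator B j)"
  have "f V - ray U f B \<tau> \<le> (\<Sum>i\<in>V. ?m i)"
    unfolding ray_def using \<tau> V
    by (intro sum_marginal_ext_ge finite_U mono nonneg submod) (auto simp: indicator_def)
  also have "\<dots> \<le> (\<Sum>i\<in>B. ?m (h i))"
    using max sum.reindex_bij_betw[OF Z(2), of ?m] by simp
  finally have "\<tau> * (f V - ray U f B \<tau>) \<le> \<tau> * (\<Sum>i\<in>B. ?m (h i))"
    using \<tau>(1) by (rule mult_left_mono)
  then have "(card B - \<tau>) * ray U f B \<tau> + \<tau> * f V - \<tau> * ray_slope U f B \<tau> \<le>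
      (\<Sum>i\<in>B. ray U f B \<tau> + \<tau> * (?m (h i) - ?m i))"
    unfolding ray_slope_def
    by (simp add: sum.distrib sum_subtractf sum_distrib_left[symmetric] algebra_simps)
  also have "\<dots> \<le> (\<Sum>i\<in>B. ray U f (insert (h i) (B - {i})) \<tau>)"
  proof (rule sum_mono)
    fix i assume "i \<in> B"
    then have "h i \<in> U" using Z by (auto simp: bij_betw_def)
    then show "ray U f B \<tau> + \<tau> * (?m (h i) - ?m i) \<le> ray U f (insert (h i) (B - {i})) \<tau>"
      unfolding ray_def using multilinear_ext_exchange[OF finite_U submod B \<open>i \<in> B\<close>, of "h i" \<tau>]
        Z(3)[OF \<open>i \<in> B\<close>] \<tau> by simp
  qed
  finally show ?thesis .
qed

text \<open>Removes the unknown event time \<tau>: in every term it is replaced by an endpoint of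
  the interval, in the unfavourable direction. Since \<open>1 \<le> card B\<close>, the factor
  \<open>card B - \<tau>\<close> is nonnegative.\<close>

lemma sum_ray_exchange_interval:
  fixes s \<tau> t :: real
  assumes B: "B \<subseteq> U" "1 \<le> card B"
    and Z: "Z \<subseteq> U" "bij_betw h B Z" "\<And>i. i \<in> B \<Longrightarrow> h i \<notin> B - {i}"
    and V: "V \<subseteq> U"
    and max: "(\<Sum>i\<in>V. marginal_ext U f i (\<lambda>j. \<tau> * indicator B j)) \<le>
      (\<Sum>i\<in>Z. marginal_ext U f i (\<lambda>j. \<tau> * indicator B j))"
    and t: "0 \<le> s" "s \<le> \<tau>" "\<tau> \<le> t" "t \<le> 1"
  shows "(card B - t) * ray U f B s + s * f V - t * ray_slope U f B s \<le>
    (\<Sum>i\<in>B. ray U f (insert (h i) (B - {i})) t)"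
proof -
  have "(card B - t) * ray U f B s \<le> (card B - \<tau>) * ray U f B \<tau>"
    using B t by (intro mult_mono ray_mono ray_bounds) auto
  moreover have "s * f V \<le> \<tau> * f V"
    using nonneg V t by (intro mult_right_mono) auto
  moreover have "\<tau> * ray_slope U f B \<tau> \<le> t * ray_slope U f B s"
    using B t by (intro mult_mono ray_slope_antimono ray_slope_bounds) auto
  moreover have "(card B - \<tau>) * ray U f B \<tau> + \<tau> * f V - \<tau> * ray_slope U f B \<tau> \<le>
    (\<Sum>i\<in>B. ray U f (insert (h i) (B - {i})) \<tau>)"
    using t by (intro sum_ray_exchange[OF B(1) Z V max]) auto
  moreover have "\<dots> \<le> (\<Sum>i\<in>B. ray U f (insert (h i) (B - {i})) t)"
    using t by (intro sum_mono ray_mono) auto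
  ultimately show ?thesis by linarith
qed

end

section \<open>Bases of a matroid\<close>

context matroid
begin

lemma finite_indep_sets: "finite \<I>"
  using finite_subset[OF indep_subset_ground] finite_ground by simp

lemma bases_indep: "B \<in> matroid_bases \<I> \<Longrightarrow> B \<in> \<I>"
  by (simp add: matroid_bases_def)

lemma bases_subset_ground: "B \<in> matroid_bases \<I> \<Longrightarrow> B \<subseteq> U"
  using bases_indep indep_subset_ground by auto

lemma finite_bases: "finite (matroid_bases \<I>)"
  using finite_indep_sets by (auto simp: matroid_bases_def)

lemma indep_subset_base:
  assumes "S \<in> \<I>"
  obtains B where "B \<in> matroid_bases \<I>" "S \<subseteq> B"
  using finite_has_maximal2[OF finite_indep_sets assms] unfolding matroid_bases_def by blast

text \<open>A larger independent set would let augmentation extend the base, against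
  maximality.\<close>

lemma card_base:
  assumes "B \<in> matroid_bases \<I>"
  shows "card B = matroid_rank \<I>"
proof -
  have "card B \<in> card ` \<I>" using bases_indep[OF assms] by auto
  moreover have "card C \<le> card B" if C: "C \<in> \<I>" for C
  proof (rule ccontr)
    assume "\<not> card C \<le> card B"
    then obtain i where "i \<in> C - B" "insert i B \<in> \<I>"
      using augmentation[OF bases_indep[OF assms] C] by auto
    then show False using assms by (auto simp: matroid_bases_def)
  qed
  ultimately show ?thesis
    unfolding matroid_rank_def using finite_indep_sets by (intro Max_eqI[symmetric]) auto
qed

text \<open>Otherwise the exchanged set would be \<open>B - {i}\<close>, too small for a base. So an
  exchange that stays among the bases brings in a new element or puts \<open>i\<close> back, as
  \<open>multilinear_ext_exchange\<close> requires.\<close>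

lemma base_exchange_notin:
  assumes "B \<in> matroid_bases \<I>" "i \<in> B" "insert j (B - {i}) \<in> matroid_bases \<I>"
  shows "j \<notin> B - {i}"
proof
  assume "j \<in> B - {i}"
  then have "insert j (B - {i}) = B - {i}" by auto
  then have "card (B - {i}) = card B" using assms card_base by metis
  moreover have "finite B" using bases_subset_ground[OF assms(1)] finite_ground finite_subset by auto
  ultimately show False using assms(2) card_Diff1_less[of B i] by simp
qed

end

section \<open>Estimates for the increments over a short interval\<close>

text \<open>
  Here \<open>exp (- \<Lambda>)\<close> and \<open>\<Lambda> * exp (- \<Lambda>)\<close> are the probabilities of no event and of one event in
  \<open>(s, t]\<close>, \<open>a\<close> and \<open>b\<close> are the values of \<open>F\<close> on the ray through the state at \<open>s\<close> and \<open>t\<close>, and \<open>S\<close> is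
  the slope of the ray at \<open>s\<close>; the two occurrences of \<open>S\<close> cancel up to second order in \<open>t - s\<close>.
\<close>
lemma poisson_step_estimate:
  fixes k \<epsilon> s t \<Lambda> a b S v L D K :: real
  assumes k: "1 \<le> k" and t: "0 < \<epsilon>" "\<epsilon> \<le> s" "s \<le> t" "t \<le> 1"
    and \<Lambda>: "\<Lambda> = k * ln (t / s)"
    and a: "0 \<le> a" "a \<le> D" and v: "0 \<le> v" "v \<le> D" and S: "0 \<le> S" "S \<le> K"
    and b: "(t - s) * S - L * (t - s)\<^sup>2 \<le> b - a" and L: "0 \<le> L"
  shows "a + (t - s) * (v - a) - (K / \<epsilon> + L + (k / \<epsilon>)\<^sup>2 * D + (k + 1) / \<epsilon> * D + D / \<epsilon>) * (t - s)\<^sup>2 \<le>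
    exp (- \<Lambda>) * b + \<Lambda> * exp (- \<Lambda>) * ((1 - t / k) * a + (s / k) * v - (t / k) * S)"
proof -
  define d where "d = t - s"
  have d: "0 \<le> d" and s: "0 < s" "0 < t" using t by (auto simp: d_def)
  \<comment> \<open>Both \<open>ln (t / s) \<le> d / s\<close> and
    \<open>d / t \<le> ln (t / s)\<close> come from \<open>ln x \<le> x - 1\<close>, at
    \<open>t / s\<close> and at \<open>s / t\<close>.\<close>
  have "ln (t / s) \<le> t / s - 1" using s by (intro ln_le_minus_one) auto
  also have "\<dots> = d / s" using s by (simp add: d_def field_simps)
  finally have ln_up: "ln (t / s) \<le> d / s" .
  have "ln (s / t) \<le> s / t - 1" using s by (intro ln_le_minus_one) auto
  also have "\<dots> = - (d / t)" using s by (simp add: d_def field_simps)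
  finally have ln_lo: "d / t \<le> ln (t / s)" using s by (simp add: ln_div)
  have ds: "d / s \<le> d / \<epsilon>" using d t s by (intro divide_left_mono) auto
  have \<Lambda>_up: "\<Lambda> \<le> k * (d / \<epsilon>)" "\<Lambda> * s \<le> k * d"
  proof -
    show "\<Lambda> \<le> k * (d / \<epsilon>)"
      unfolding \<Lambda> using k ln_up ds by (intro mult_left_mono) auto
    show "\<Lambda> * s \<le> k * d"
      unfolding \<Lambda> mult.assoc using k ln_up s by (intro mult_left_mono) (auto simp: pos_le_divide_eq)
  qed
  have \<Lambda>_lo: "k * d \<le> \<Lambda> * t"
    using k ln_lo s unfolding \<Lambda> by (auto intro!: mult_left_mono simp: mult.assoc pos_divide_le_eq)
  have \<Lambda>0: "0 \<le> \<Lambda>" unfolding \<Lambda> using k t s by auto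
  define p where "p = exp (- \<Lambda>)"
  have p: "0 < p" "p \<le> 1" "1 - \<Lambda> \<le> p"
    using \<Lambda>0 exp_ge_add_one_self[of "- \<Lambda>"] by (auto simp: p_def)
  have K: "0 \<le> K" using S by linarith
  have D: "0 \<le> D" using a by linarith
  \<comment> \<open>Growth of the ray against the loss at the event:
    \<open>\<Lambda> * (t / k)\<close> exceeds \<open>d\<close> by at most
    \<open>d\<^sup>2 / \<epsilon>\<close>, which gives \<open>K / \<epsilon>\<close>;
    \<open>L\<close> is the curvature error in \<open>b - a\<close>.\<close>
  have S_term: "- (K / \<epsilon> + L) * d\<^sup>2 \<le> p * (b - a) - \<Lambda> * p * (t / k) * S"
  proof -
    have "\<Lambda> * t \<le> k * d + k * (d / \<epsilon>) * d"
      using \<Lambda>_up mult_right_mono[OF \<Lambda>_up(1) d] by (simp add: d_def algebra_simps)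
    then have "\<Lambda> * (t / k) \<le> d + d\<^sup>2 / \<epsilon>"
      using k by (simp add: field_simps power2_eq_square)
    then have "\<Lambda> * (t / k) * S \<le> (d + d\<^sup>2 / \<epsilon>) * S"
      using S by (intro mult_right_mono) auto
    moreover have "d\<^sup>2 / \<epsilon> * S \<le> d\<^sup>2 / \<epsilon> * K"
      using S t by (intro mult_left_mono) auto
    ultimately have "- (K / \<epsilon> + L) * d\<^sup>2 \<le> (b - a) - \<Lambda> * (t / k) * S"
      using b by (simp add: d_def[symmetric] algebra_simps)
    moreover have "- (K / \<epsilon> + L) * d\<^sup>2 \<le> p * (- (K / \<epsilon> + L) * d\<^sup>2)"
    proof -
      have "p * ((K / \<epsilon> + L) * d\<^sup>2) \<le> 1 * ((K / \<epsilon> + L) * d\<^sup>2)"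
        using p K L t by (intro mult_right_mono mult_nonneg_nonneg add_nonneg_nonneg) auto
      then show ?thesis by (simp add: algebra_simps)
    qed
    moreover have "p * (- (K / \<epsilon> + L) * d\<^sup>2) \<le> p * ((b - a) - \<Lambda> * (t / k) * S)"
      using calculation(1) p by (intro mult_left_mono) auto
    ultimately show ?thesis by (simp add: algebra_simps)
  qed
  \<comment> \<open>\<open>p + \<Lambda> * p\<close> is the probability of at most one event; by
    \<open>1 - \<Lambda> \<le> p\<close> it falls short of 1 by at most
    \<open>\<Lambda>\<^sup>2\<close>.\<close>
  have mass_term: "- ((k / \<epsilon>)\<^sup>2 * D) * d\<^sup>2 \<le> (p + \<Lambda> * p - 1) * a"
  proof -
    have "(1 - \<Lambda>) * (1 + \<Lambda>) \<le> p * (1 + \<Lambda>)" using p \<Lambda>0 by (intro mult_right_mono) auto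
    then have "1 - (p + \<Lambda> * p) \<le> \<Lambda>\<^sup>2" by (simp add: algebra_simps power2_eq_square)
    also have "\<dots> \<le> (k * (d / \<epsilon>))\<^sup>2" using \<Lambda>_up \<Lambda>0 by (intro power_mono) auto
    finally have "(1 - (p + \<Lambda> * p)) * a \<le> (k * (d / \<epsilon>))\<^sup>2 * a"
      using a by (intro mult_right_mono) auto
    also have "\<dots> \<le> (k * (d / \<epsilon>))\<^sup>2 * D" using a by (intro mult_left_mono) auto
    finally show ?thesis by (simp add: power_mult_distrib power_divide algebra_simps)
  qed
  \<comment> \<open>Two relative losses: \<open>d / \<epsilon>\<close> because \<open>s\<close>
    stands where \<open>t\<close> would give the full \<open>d\<close>, and
    \<open>k * (d / \<epsilon>)\<close> because \<open>p\<close> is only known to be at least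
    \<open>1 - \<Lambda>\<close>.\<close>
  have v_term: "d * v - ((k + 1) / \<epsilon> * D) * d\<^sup>2 \<le> \<Lambda> * p * (s / k) * v"
  proof -
    have "d * (1 - d / \<epsilon> - k * (d / \<epsilon>)) \<le> \<Lambda> * p * (s / k)"
    proof -
      have "k * d - \<Lambda> * d \<le> \<Lambda> * s" using \<Lambda>_lo by (simp add: d_def algebra_simps)
      moreover have "\<Lambda> * d \<le> k * (d / \<epsilon>) * d" using \<Lambda>_up d by (intro mult_right_mono) auto
      ultimately have l: "d - d / \<epsilon> * d \<le> \<Lambda> * (s / k)"
        using k by (simp add: field_simps)
      have u: "\<Lambda> * (s / k) \<le> d" using \<Lambda>_up(2) k by (simp add: field_simps)
      have "\<Lambda> * (s / k) - d * (k * (d / \<epsilon>)) \<le> \<Lambda> * (s / k) - \<Lambda> * (s / k) * \<Lambda>"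
        using mult_mono[OF u \<Lambda>_up(1) d \<Lambda>0] by simp
      also have "\<dots> = \<Lambda> * (s / k) * (1 - \<Lambda>)" by (simp only: right_diff_distrib mult_1_right)
      also have "\<dots> \<le> \<Lambda> * (s / k) * p" using p \<Lambda>0 s k by (intro mult_left_mono) auto
      finally show ?thesis using l by (simp add: algebra_simps)
    qed
    then have "d * (1 - d / \<epsilon> - k * (d / \<epsilon>)) * v \<le> \<Lambda> * p * (s / k) * v"
      using v by (intro mult_right_mono) auto
    moreover have "(k + 1) / \<epsilon> * d\<^sup>2 * v \<le> (k + 1) / \<epsilon> * d\<^sup>2 * D"
      using v k t by (intro mult_left_mono) auto
    moreover have "d * (1 - d / \<epsilon> - k * (d / \<epsilon>)) * v = d * v - (k + 1) / \<epsilon> * d\<^sup>2 * v"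
      by (simp add: algebra_simps power2_eq_square add_divide_distrib)
    ultimately show ?thesis by (simp add: algebra_simps)
  qed
  have a_term: "\<Lambda> * p * (t / k) * a \<le> d * a + (D / \<epsilon>) * d\<^sup>2"
  proof -
    have "\<Lambda> * t \<le> k * d + k * (d / \<epsilon>) * d"
      using \<Lambda>_up mult_right_mono[OF \<Lambda>_up(1) d] by (simp add: d_def algebra_simps)
    then have "\<Lambda> * (t / k) \<le> d + d\<^sup>2 / \<epsilon>"
      using k by (simp add: field_simps power2_eq_square)
    moreover have "\<Lambda> * (t / k) * p \<le> \<Lambda> * (t / k)"
      using p \<Lambda>0 s k by (intro mult_right_le_one_le) auto
    ultimately have "\<Lambda> * p * (t / k) * a \<le> (d + d\<^sup>2 / \<epsilon>) * a"
      using a by (intro mult_right_mono) (auto simp: algebra_simps)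
    moreover have "d\<^sup>2 / \<epsilon> * a \<le> d\<^sup>2 / \<epsilon> * D" using a t by (intro mult_left_mono) auto
    ultimately show ?thesis by (simp add: algebra_simps)
  qed
  have "p * b + \<Lambda> * p * ((1 - t / k) * a + (s / k) * v - (t / k) * S) - a =
      (p * (b - a) - \<Lambda> * p * (t / k) * S) + (p + \<Lambda> * p - 1) * a
        + \<Lambda> * p * (s / k) * v - \<Lambda> * p * (t / k) * a"
    by (simp add: algebra_simps)
  also have "\<dots> \<ge> d * (v - a) - (K / \<epsilon> + L + (k / \<epsilon>)\<^sup>2 * D + (k + 1) / \<epsilon> * D + D / \<epsilon>) * d\<^sup>2"
    using S_term mass_term v_term a_term 
    unfolding mult_minus_left distrib_right right_diff_distrib by linarith
  finally show ?thesis by (simp add: d_def p_def algebra_simps)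
qed

text \<open>A discrete Gronwall argument: over \<open>n\<close> equal steps of length
  \<open>d\<close> the gap \<open>v - g\<close> shrinks by the factor \<open>1 - d\<close> per step,
  up to \<open>C * d\<^sup>2\<close>, and the accumulated error \<open>n * C * d\<^sup>2\<close>
  vanishes as \<open>n\<close> grows. Only increments enter, so no regularity of \<open>g\<close>
  has to be shown.\<close>

lemma exp_growth_of_increments:
  fixes g :: "real \<Rightarrow> real" and v C a b :: real
  assumes incr: "\<And>s t. a \<le> s \<Longrightarrow> s < t \<Longrightarrow> t \<le> b \<Longrightarrow> g s + (t - s) * (v - g s) - C * (t - s)\<^sup>2 \<le> g t"
    and "0 \<le> g a" "0 \<le> v" "0 \<le> C" "a \<le> b"
  shows "(1 - exp (- (b - a))) * v \<le> g b"
proof -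
  \<comment> \<open>\<open>b - a < n\<close> makes \<open>d \<le> 1\<close>, so that the factor
    \<open>1 - d\<close> is nonnegative.\<close>
  have bound: "v - g b \<le> exp (- (b - a)) * v + C * (b - a)\<^sup>2 / n" if n: "b - a < real n" for n
  proof -
    have n0: "0 < real n" using that assms by linarith
    define d where "d = (b - a) / n"
    have d: "0 \<le> d" "d \<le> 1" using n n0 assms by (auto simp: d_def)
    have nd: "real n * d = b - a" using n0 by (simp add: d_def)
    have "v - g (a + j * d) \<le> (1 - d) ^ j * v + j * (C * d\<^sup>2)" if "j \<le> n" for j
      using that
    proof (induction j)
      case 0
      then show ?case using assms by simp
    next
      case (Suc j)
      let ?s = "a + j * d" and ?t = "a + Suc j * d"
      have "Suc j * d \<le> n * d" using Suc.prems d by (intro mult_right_mono) auto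
      then have tb: "?t \<le> b" using nd by simp
      have ts: "?t - ?s = d" by (simp add: algebra_simps)
      have "g ?s + d * (v - g ?s) - C * d\<^sup>2 \<le> g ?t"
      \<comment> \<open>\<open>d = 0\<close> happens when \<open>a = b\<close>, whereas
        \<open>incr\<close> speaks only of \<open>s < t\<close>.\<close>
      proof (cases "d = 0")
        case False
        then have "g ?s + (?t - ?s) * (v - g ?s) - C * (?t - ?s)\<^sup>2 \<le> g ?t"
          using d tb by (intro incr) (auto simp: algebra_simps)
        then show ?thesis unfolding ts .
      qed simp
      then have "v - g ?t \<le> (1 - d) * (v - g ?s) + C * d\<^sup>2" by (simp add: algebra_simps)
      also have "(1 - d) * (v - g ?s) \<le> (1 - d) * ((1 - d) ^ j * v + j * (C * d\<^sup>2))"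
        using d Suc by (intro mult_left_mono) auto
      also have "\<dots> \<le> (1 - d) ^ Suc j * v + j * (C * d\<^sup>2)"
        using d assms by (auto simp: distrib_left intro!: mult_left_le_one_le)
      finally show ?case by (simp add: algebra_simps)
    qed
    from this[of n] have "v - g b \<le> (1 - d) ^ n * v + n * (C * d\<^sup>2)"
      using nd by simp
    also have "(1 - d) ^ n \<le> exp (- d) ^ n"
      using d exp_ge_add_one_self[of "- d"] by (intro power_mono) auto
    also have "exp (- d) ^ n = exp (- (b - a))"
      unfolding exp_of_nat_mult[symmetric] using nd by simp
    also have "n * (C * d\<^sup>2) = C * (b - a)\<^sup>2 / n"
      using n0 by (simp add: d_def power2_eq_square field_simps)
    finally show ?thesis using assms by (simp add: mult_right_mono)
  qed
  have "(\<lambda>n. exp (- (b - a)) * v + C * (b - a)\<^sup>2 / real n) \<longlonglongrightarrow> exp (- (b - a)) * v + 0"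
    by (intro tendsto_intros real_tendsto_divide_at_top filterlim_real_sequentially)
  moreover have "eventually (\<lambda>n. v - g b \<le> exp (- (b - a)) * v + C * (b - a)\<^sup>2 / real n) sequentially"
    using filterlim_real_sequentially[unfolded filterlim_at_top_dense, rule_format, of "b - a"]
    by eventually_elim (rule bound)
  ultimately have "v - g b \<le> exp (- (b - a)) * v + 0"
    by (intro tendsto_lowerbound) auto
  then show ?thesis by (simp add: algebra_simps)
qed

text \<open>In a sorted list the positions with entries at most \<open>r\<close> form an initial
  segment. This turns event times into counts, in which the Poisson property is stated. Positions
  start at 0, hence the strict inequality.\<close>

lemma sorted_list_of_set_nth_le_iff:
  fixes S :: "'b::linorder set"
  assumes "finite S" "n < card S"
  shows "sorted_list_of_set S ! n \<le> r \<longleftrightarrow> n < card (S \<inter> {..r})"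
proof -
  define xs where "xs = sorted_list_of_set S"
  have xs: "sorted xs" "distinct xs" "set xs = S" "length xs = card S"
    using assms by (auto simp: xs_def)
  have inter: "S \<inter> {..r} = set (filter (\<lambda>x. x \<le> r) xs)" using xs by auto
  have card: "card (S \<inter> {..r}) = card {i. i < length xs \<and> xs ! i \<le> r}"
    unfolding inter distinct_card[OF distinct_filter[OF xs(2)]] by (rule length_filter_conv_card)
  show ?thesis
  proof
    assume "sorted_list_of_set S ! n \<le> r"
    then have "{..n} \<subseteq> {i. i < length xs \<and> xs ! i \<le> r}"
      using xs(4) assms(2) by (auto simp: xs_def[symmetric] intro: order_trans[OF sorted_nth_mono[OF xs(1)]])
    then have "card {..n} \<le> card {i. i < length xs \<and> xs ! i \<le> r}"
      by (intro card_mono) auto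
    then show "n < card (S \<inter> {..r})" unfolding card by simp
  next
    assume "n < card (S \<inter> {..r})"
    show "sorted_list_of_set S ! n \<le> r"
    proof (rule ccontr)
      assume "\<not> sorted_list_of_set S ! n \<le> r"
      then have "i < n" if "i < length xs" "xs ! i \<le> r" for i
        using that sorted_nth_mono[OF xs(1), of n i] by (fastforce simp: xs_def[symmetric] not_le)
      then have "card {i. i < length xs \<and> xs ! i \<le> r} \<le> card {..<n}"
        by (intro card_mono) auto
      then show False using \<open>n < card (S \<inter> {..r})\<close> unfolding card by simp
    qed
  qed
qed

section \<open>Information available at a given time\<close>

text \<open>\<open>n\<close> is bounded by the number of events because \<open>exchange\<close> is
  assumed only for events that occur.\<close>

lemma (in gs_poisson) gs_state_base:
  assumes "\<omega> \<in> space M" "n \<le> card (events_before 1 P \<omega>)"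
  shows "gs_state A\<^sub>0 X h n \<omega> \<in> matroid_bases \<I>"
  using assms(2)
proof (induction n)
  case 0
  then show ?case using init_base[OF assms(1)] by simp
next
  case (Suc n)
  then have B: "gs_state A\<^sub>0 X h n \<omega> \<in> matroid_bases \<I>" by simp
  show ?case
  proof (cases "gs_state A\<^sub>0 X h n \<omega> = {}")
    case False
    then show ?thesis
      using exchange[OF assms(1), of n] Suc.prems draw_in[OF B False assms(1), of n]
      by (simp add: Let_def)
  qed (use B in simp)
qed

text \<open>The cases \<epsilon> = 1, with an empty time interval, and rank 0, with no element to
  draw, are treated separately in the theorem; here every base is nonempty and one may divide by the
  rank.\<close>

locale gs_poisson_matroid = gs_poisson M U \<I> f \<epsilon> R P X A\<^sub>0 Z h + matroid U \<I> + monotone_submodular U f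
  for M :: "'w measure" and U :: "'a set" and \<I> f \<epsilon> R P X A\<^sub>0 Z h +
  assumes \<epsilon>_pos: "0 < \<epsilon>" and \<epsilon>_less: "\<epsilon> < 1" and rank_pos: "0 < matroid_rank \<I>"
begin

abbreviation "\<B> \<equiv> matroid_bases \<I>"

abbreviation "k \<equiv> real (matroid_rank \<I>)"

lemma finite_P: "\<omega> \<in> space M \<Longrightarrow> finite (P \<omega>)"
  and P_subset: "\<omega> \<in> space M \<Longrightarrow> P \<omega> \<subseteq> {\<epsilon><..1}"
  using poisson by (auto simp: poisson_process_def)

lemma num_events_add:
  assumes "\<omega> \<in> space M" "r \<le> s" "s \<le> t"
  shows "num_events P r t \<omega> = num_events P r s \<omega> + num_events P s t \<omega>"
proof -
  have "P \<omega> \<inter> {r<..t} = (P \<omega> \<inter> {r<..s}) \<union> (P \<omega> \<inter> {s<..t})" using assms by auto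
  then show ?thesis
    unfolding num_events_def using finite_P[OF assms(1)]
    by (simp add: card_Un_disjoint disjoint_iff)
qed

lemma events_before_eq: "\<omega> \<in> space M \<Longrightarrow> r < 1 \<Longrightarrow> events_before 1 P \<omega> \<inter> {..r} = P \<omega> \<inter> {\<epsilon><..r}"
  using P_subset by (force simp: events_before_def)

lemma num_events_le_card:
  assumes "\<omega> \<in> space M" "r < 1"
  shows "num_events P \<epsilon> r \<omega> \<le> card (events_before 1 P \<omega>)"
  unfolding num_events_def events_before_eq[OF assms, symmetric]
  using finite_P[OF assms(1)] by (intro card_mono) (auto simp: events_before_def)

text \<open>\<open>r < 1\<close> matters: a missing event has the default time 1, which must not
  count as at most \<open>r\<close>.\<close>

lemma event_time_le_iff:
  assumes "\<omega> \<in> space M" "r < 1"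
  shows "event_time 1 P n \<omega> \<le> r \<longleftrightarrow> n < num_events P \<epsilon> r \<omega>"
proof (cases "n < card (events_before 1 P \<omega>)")
  case True
  have "finite (events_before 1 P \<omega>)" using finite_P[OF assms(1)] by (simp add: events_before_def)
  from sorted_list_of_set_nth_le_iff[OF this True, of r] True show ?thesis
    by (simp add: event_time_def events_before_eq[OF assms] num_events_def)
next
  case False
  then show ?thesis
    using num_events_le_card[OF assms] assms by (auto simp: event_time_def)
qed

lemma event_time_le_1: "\<omega> \<in> space M \<Longrightarrow> event_time 1 P n \<omega> \<le> 1"
  using finite_P[of \<omega>] nth_mem[of n "sorted_list_of_set (events_before 1 P \<omega>)"]
  by (auto simp: event_time_def events_before_def)

lemma num_events_eq_0: "r \<le> \<epsilon> \<Longrightarrow> num_events P \<epsilon> r \<omega> = 0"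
  by (simp add: num_events_def)

lemma space_R: "space R = space M" and sets_R: "sets R \<subseteq> sets M"
  using ties by (auto simp: subalgebra_def)

text \<open>Time and number of draws are separate parameters because draws are indexed by events:
  \<open>filt s n\<close> serves for independence from the clock after \<open>s\<close>, and
  \<open>filt 1 n\<close>, with the entire clock, for independence from draw
  \<open>n\<close>.\<close>

definition filt_events :: "real \<Rightarrow> nat \<Rightarrow> 'w set set" where
  "filt_events s n = sets R \<union> {{\<omega> \<in> space M. num_events P \<epsilon> r \<omega> = m} | r m. \<epsilon> \<le> r \<and> r \<le> s}
     \<union> (\<Union>m<n. draw_events M \<B> X m)"

definition filt :: "real \<Rightarrow> nat \<Rightarrow> 'w measure" where
  "filt s n = sigma (space M) (filt_events s n)"

lemma filt_events_Pow: "filt_events s n \<subseteq> Pow (space M)"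
  using sets.sets_into_space[of _ R] space_R by (auto simp: filt_events_def draw_events_def)

lemma space_filt [simp]: "space (filt s n) = space M"
  using filt_events_Pow by (simp add: filt_def space_measure_of)

lemma sets_filt: "sets (filt s n) = sigma_sets (space M) (filt_events s n)"
  using filt_events_Pow by (simp add: filt_def sets_measure_of)

lemma filt_basic: "A \<in> filt_events s n \<Longrightarrow> A \<in> sets (filt s n)"
  by (simp add: sets_filt)

lemma filt_ties: "A \<in> sets R \<Longrightarrow> A \<in> sets (filt s n)"
  by (intro filt_basic) (simp add: filt_events_def)

lemma filt_num_events:
  "\<epsilon> \<le> r \<Longrightarrow> r \<le> s \<Longrightarrow> {\<omega> \<in> space M. num_events P \<epsilon> r \<omega> = m} \<in> sets (filt s n)"
  by (intro filt_basic) (unfold filt_events_def, blast)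

lemma filt_draw:
  "B \<in> \<B> \<Longrightarrow> i \<in> B \<Longrightarrow> m < n \<Longrightarrow> {\<omega> \<in> space M. X m B \<omega> = i} \<in> sets (filt s n)"
  by (intro filt_basic) (unfold filt_events_def draw_events_def, blast)

lemma filt_mono:
  assumes "s \<le> t" "m \<le> n"
  shows "sets (filt s m) \<subseteq> sets (filt t n)"
  unfolding sets_filt using assms by (intro sigma_sets_mono') (force simp: filt_events_def)

lemma num_events_filt:
  assumes "\<epsilon> \<le> r" "r \<le> s"
  shows "num_events P \<epsilon> r \<in> measurable (filt s n) (count_space UNIV)"
proof -
  have "num_events P \<epsilon> r -` {m} \<inter> space M \<in> sets (filt s n)" for m
  proof -
    have "num_events P \<epsilon> r -` {m} \<inter> space M = {\<omega> \<in> space M. num_events P \<epsilon> r \<omega> = m}" by auto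
    then show ?thesis using filt_num_events[OF assms] by simp
  qed
  then show ?thesis by (simp add: measurable_count_space_eq_countable)
qed

lemma num_events_filt_sets:
  assumes "\<epsilon> \<le> r" "r \<le> s"
  shows "{\<omega> \<in> space M. Q (num_events P \<epsilon> r \<omega>)} \<in> sets (filt s n)"
  using measurable_sets[OF num_events_filt[OF assms, of n], of "Collect Q"]
  by (simp add: vimage_def Int_def conj_commute)

section \<open>The history at an event compared with the information at a fixed time\<close>

definition history_events :: "nat \<Rightarrow> 'w set set" where
  "history_events n = sets R \<union> {{\<omega> \<in> space M. event_time 1 P m \<omega> \<le> t} | m t. m \<le> n}
          \<union> (\<Union>m<n. draw_events M \<B> X m)"

lemma history_events_Pow: "history_events n \<subseteq> Pow (space M)"
  using sets.sets_into_space[of _ R] space_R by (auto simp: history_events_def draw_events_def)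

lemma space_history [simp]: "space (history M R P \<B> X n) = space M"
  using history_events_Pow[of n] by (simp add: history_def space_measure_of history_events_def)

lemma sets_history: "sets (history M R P \<B> X n) = sigma_sets (space M) (history_events n)"
  using history_events_Pow[of n] by (simp add: history_def sets_measure_of history_events_def)

lemma history_events_cases:
  assumes "H \<in> history_events n"
  obtains (filt) "H \<in> filt_events s n"
    | (time) m t where "m \<le> n" "H = {\<omega> \<in> space M. event_time 1 P m \<omega> \<le> t}"
  using assms unfolding history_events_def filt_events_def by auto

text \<open>
  The \<open>n\<close>-th event may come after time \<open>s\<close>, so only the trace of the history on the event
  that it comes at time \<open>s\<close> or earlier is known at time \<open>s\<close>.
\<close>
lemma history_trace:
  assumes H: "H \<in> sets (history M R P \<B> X n)" and s: "\<epsilon> \<le> s" "s < 1"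
  shows "H \<inter> {\<omega> \<in> space M. n < num_events P \<epsilon> s \<omega>} \<in> sets (filt s n)"
proof -
  let ?E = "{\<omega> \<in> space M. n < num_events P \<epsilon> s \<omega>}"
  have E: "?E \<in> sets (filt s n)" using s by (intro num_events_filt_sets) auto
  show ?thesis
    using H unfolding sets_history
  proof (induction rule: sigma_sets.induct)
    case (Basic H)
    then show ?case
    proof (cases rule: history_events_cases[where s = s])
      case filt
      then show ?thesis using E by (auto intro: filt_basic)
    next
      case (time m t)
      have "H \<inter> ?E = {\<omega> \<in> space M. m < num_events P \<epsilon> (min t s) \<omega>} \<inter> ?E"
      proof -
        \<comment> \<open>On \<open>?E\<close> the events up to number \<open>n\<close> come by time
          \<open>s\<close>, so the bound \<open>t\<close> may be cut down to \<open>min t s\<close>,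
          which is below 1 and at most \<open>s\<close>.\<close>
        have "event_time 1 P m \<omega> \<le> t \<longleftrightarrow> m < num_events P \<epsilon> (min t s) \<omega>"
          if "\<omega> \<in> space M" "n < num_events P \<epsilon> s \<omega>" for \<omega>
        proof -
          have "event_time 1 P m \<omega> \<le> s"
            using that time s by (subst event_time_le_iff) auto
          then show ?thesis
            using event_time_le_iff[OF that(1), of "min t s" m] s by auto
        qed
        then show ?thesis unfolding time(2) by auto
      qed
      also have "\<dots> \<in> sets (filt s n)"
      proof (cases "\<epsilon> \<le> t")
        case True
        then show ?thesis using s E by (intro sets.Int num_events_filt_sets) auto
      next
        case False
        then show ?thesis by (simp add: num_events_eq_0)
      qed
      finally show ?thesis .
    qed
  next
    case (Compl H)
    have "(space M - H) \<inter> ?E = ?E - H \<inter> ?E" by auto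
    then show ?case using Compl E by auto
  next
    case (Union H)
    have "(\<Union> (range H)) \<inter> ?E = (\<Union>i. H i \<inter> ?E)" by auto
    also have "\<dots> \<in> sets (filt s n)" using Union.IH by (intro sets.countable_UN) auto
    finally show ?case .
  qed simp
qed

text \<open>For \<open>t < 1\<close> the event is read off the counts; for larger \<open>t\<close>
  it is the whole space, as no event time exceeds 1. Through this inclusion \<open>h n\<close>
  becomes independent of draw \<open>n\<close>.\<close>

lemma history_subset_filt: "sets (history M R P \<B> X n) \<subseteq> sets (filt 1 n)"
proof -
  have "H \<in> sets (filt 1 n)" if "H \<in> history_events n" for H
    using that
  proof (cases rule: history_events_cases[where s = 1])
    case H: (time m t)
    show ?thesis
    proof (cases "t < 1")
      case True
      then have "H = {\<omega> \<in> space M. m < num_events P \<epsilon> t \<omega>}"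
        unfolding H(2) using event_time_le_iff by auto
      then show ?thesis
        using True num_events_filt_sets[of t 1 "\<lambda>j. m < j" n] num_events_eq_0
        by (cases "\<epsilon> \<le> t") auto
    next
      case False
      then have "H = space M"
        unfolding H(2) using event_time_le_1 by (force intro: order_trans)
      then show ?thesis using sets.top[of "filt 1 n"] by simp
    qed
  qed (rule filt_basic)
  then show ?thesis
    unfolding sets_history using sets.sigma_sets_subset[of "history_events n" "filt 1 n"] by auto
qed

lemma base_finite: "B \<in> \<B> \<Longrightarrow> finite B"
  using bases_subset_ground finite_ground by (rule finite_subset)

lemma base_nonempty: "B \<in> \<B> \<Longrightarrow> B \<noteq> {}"
  using card_base[of B] rank_pos by auto

lemma gs_state_Suc_eq:
  assumes "gs_state A\<^sub>0 X h n \<omega> = B" "B \<in> \<B>"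
  shows "gs_state A\<^sub>0 X h (Suc n) \<omega> = insert (h n \<omega> (X n B \<omega>)) (B - {X n B \<omega>})"
  using assms base_nonempty by (simp add: Let_def)

text \<open>The condition on the count is part of the event because choices at events after
  \<open>s\<close> are not known at time \<open>s\<close>.\<close>

lemma gs_state_filt:
  assumes s: "\<epsilon> \<le> s" "s < 1"
  shows "{\<omega> \<in> space M. n \<le> num_events P \<epsilon> s \<omega> \<and> gs_state A\<^sub>0 X h n \<omega> = B} \<in> sets (filt s n)"
proof (induction n arbitrary: B)
  case 0
  have "{\<omega> \<in> space M. A\<^sub>0 \<omega> = B} = A\<^sub>0 -` {B} \<inter> space R" by (auto simp: space_R)
  also have "\<dots> \<in> sets R" using init_measurable by (rule measurable_sets) simp
  finally show ?case by (simp add: filt_ties)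
next
  case (Suc n)
  let ?E = "\<lambda>C. {\<omega> \<in> space M. n \<le> num_events P \<epsilon> s \<omega> \<and> gs_state A\<^sub>0 X h n \<omega> = C}"
  let ?H = "\<lambda>C i. (\<lambda>\<omega>. h n \<omega> i) -` {j. insert j (C - {i}) = B} \<inter> space M"
  let ?N = "{\<omega> \<in> space M. n < num_events P \<epsilon> s \<omega>}"
  \<comment> \<open>Decomposition by the previous state \<open>C\<close> and the drawn element
    \<open>i\<close>. State \<open>Suc n\<close> is produced by event number \<open>n\<close>, hence
    the strict inequality in \<open>?N\<close>, which is the trace on which
    \<open>history_trace\<close> makes \<open>h n\<close> known.\<close>
  have "{\<omega> \<in> space M. Suc n \<le> num_events P \<epsilon> s \<omega> \<and> gs_state A\<^sub>0 X h (Suc n) \<omega> = B} =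
      (\<Union>C\<in>\<B>. \<Union>i\<in>C. ?E C \<inter> {\<omega> \<in> space M. X n C \<omega> = i} \<inter> (?H C i \<inter> ?N))"
    (is "?L = ?R")
  proof (rule set_eqI)
    fix \<omega>
    show "\<omega> \<in> ?L \<longleftrightarrow> \<omega> \<in> ?R"
    proof (cases "\<omega> \<in> space M \<and> n < num_events P \<epsilon> s \<omega>")
      case True
      define C where "C = gs_state A\<^sub>0 X h n \<omega>"
      have C: "C \<in> \<B>"
        unfolding C_def using True num_events_le_card[of \<omega> s] s by (intro gs_state_base) auto
      have "X n C \<omega> \<in> C" using C True base_nonempty by (intro draw_in) auto
      then show ?thesis
        using True C gs_state_Suc_eq[OF C_def[symmetric] C] by (auto simp: C_def[symmetric] Suc_le_eq simp del: gs_state.simps)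
    qed auto
  qed
  also have "\<dots> \<in> sets (filt s (Suc n))"
  proof (intro sets.finite_UN finite_bases)
    fix C assume "C \<in> \<B>"
    then show "finite C" by (rule base_finite)
  next
    fix C i assume C: "C \<in> \<B>" "i \<in> C"
    have "?E C \<in> sets (filt s (Suc n))" using Suc filt_mono[of s s n "Suc n"] by auto
    moreover have "{\<omega> \<in> space M. X n C \<omega> = i} \<in> sets (filt s (Suc n))"
      using C by (intro filt_draw) auto
    moreover have "i \<in> U" using C bases_subset_ground by auto
    from measurable_sets[OF bij_measurable[OF this, of n], of "{j. insert j (C - {i}) = B}"]
    have "?H C i \<in> sets (history M R P \<B> X n)" by simp
    from history_trace[OF this s] filt_mono[of s s n "Suc n"]
    have "?H C i \<inter> ?N \<in> sets (filt s (Suc n))" by auto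
    ultimately show "?E C \<inter> {\<omega> \<in> space M. X n C \<omega> = i} \<inter> (?H C i \<inter> ?N) \<in> sets (filt s (Suc n))"
      by (rule sets.Int[OF sets.Int])
  qed
  finally show ?case .
qed

section \<open>Independence of draws, past and future\<close>

lemma source_events_subset: "source_events M R \<epsilon> P \<B> X i \<subseteq> sets M"
  using indep_sources by (auto simp: indep_sets_def)

lemma Int_stable_source_events: "Int_stable (source_events M R \<epsilon> P \<B> X i)"
proof -
  have *: "Int_stable (sigma_sets (space M) G)" if "G \<subseteq> Pow (space M)" for G
  proof -
    interpret sigma_algebra "space M" "sigma_sets (space M) G"
      using that by (rule sigma_algebra_sigma_sets)
    show ?thesis by (auto simp: Int_stable_def)
  qed
  show ?thesis
  proof (cases i)
    case Ties
    then show ?thesis by (auto simp: Int_stable_def)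
  next
    case Clock
    show ?thesis unfolding Clock source_events.simps by (rule *) auto
  next
    case (Draw n)
    show ?thesis unfolding Draw source_events.simps by (rule *) (auto simp: draw_events_def)
  qed
qed

text \<open>Used twice: for one draw against ties, clock and earlier draws, and for the clock
  against ties and all draws.\<close>

lemma indep_collect_sources:
  assumes "I \<inter> J = {}"
  shows "indep_set (sigma_sets (space M) (\<Union>i\<in>I. source_events M R \<epsilon> P \<B> X i))
    (sigma_sets (space M) (\<Union>i\<in>J. source_events M R \<epsilon> P \<B> X i))"
proof -
  let ?I = "case_bool I J"
  have "indep_sets (\<lambda>b. sigma_sets (space M) (\<Union>i\<in>?I b. source_events M R \<epsilon> P \<B> X i)) UNIV"
  proof (rule indep_sets_collect_sigma)
    show "indep_sets (source_events M R \<epsilon> P \<B> X) (\<Union>b\<in>UNIV. ?I b)"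
      using indep_sources by (rule indep_sets_mono_index[rotated]) auto
    show "disjoint_family_on ?I UNIV"
      using assms by (auto simp: disjoint_family_on_def split: bool.splits)
  qed (rule Int_stable_source_events)
  then show ?thesis
    unfolding indep_set_def by (rule indep_sets_mono_sets) (auto split: bool.split)
qed

lemma sets_R_source: "sets R = source_events M R \<epsilon> P \<B> X Ties"
  and draw_source: "draw_events M \<B> X n \<subseteq> source_events M R \<epsilon> P \<B> X (Draw n)"
  and clock_source: "\<epsilon> \<le> s \<Longrightarrow> s \<le> t \<Longrightarrow> t \<le> 1 \<Longrightarrow>
    {\<omega> \<in> space M. num_events P s t \<omega> = m} \<in> source_events M R \<epsilon> P \<B> X Clock"
  by (auto intro: sigma_sets.Basic)

lemma filt_events_subset_sources:
  assumes "s \<le> 1"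
  shows "filt_events s n \<subseteq>
    (\<Union>i\<in>insert Ties (insert Clock (Draw ` {..<n})). source_events M R \<epsilon> P \<B> X i)"
proof
  fix A assume "A \<in> filt_events s n"
  then consider "A \<in> sets R" | m where "m < n" "A \<in> draw_events M \<B> X m"
    | r j where "A = {\<omega> \<in> space M. num_events P \<epsilon> r \<omega> = j}" "\<epsilon> \<le> r" "r \<le> s"
    unfolding filt_events_def by auto
  then have "\<exists>i\<in>insert Ties (insert Clock (Draw ` {..<n})). A \<in> source_events M R \<epsilon> P \<B> X i"
  proof cases
    case 1
    then show ?thesis using sets_R_source by blast
  next
    case 2
    then show ?thesis using draw_source[of m] by blast
  next
    case 3
    have "A \<in> source_events M R \<epsilon> P \<B> X Clock"
      unfolding 3(1) using 3 assms by (intro clock_source) auto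
    then show ?thesis by blast
  qed
  then show "A \<in> (\<Union>i\<in>insert Ties (insert Clock (Draw ` {..<n})). source_events M R \<epsilon> P \<B> X i)"
    by blast
qed

lemma filt_subset_events:
  assumes "s \<le> 1"
  shows "sets (filt s n) \<subseteq> sets M"
proof -
  have "filt_events s n \<subseteq> sets M"
    using filt_events_subset_sources[OF assms, of n] source_events_subset by blast
  then show ?thesis unfolding sets_filt by (rule sets.sigma_sets_subset)
qed

text \<open>The clock is a source of its own, so all of it, even after the \<open>n\<close>-th
  event, may be put on the left; this avoids stopping times.\<close>

lemma indep_draw: "indep_set (sets (filt 1 n)) (sigma_sets (space M) (draw_events M \<B> X n))"
proof -
  let ?I = "insert Ties (insert Clock (Draw ` {..<n}))"
  have "sets (filt 1 n) \<subseteq> sigma_sets (space M) (\<Union>i\<in>?I. source_events M R \<epsilon> P \<B> X i)"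
    unfolding sets_filt by (intro sigma_sets_mono' filt_events_subset_sources) simp
  moreover have "sigma_sets (space M) (draw_events M \<B> X n) \<subseteq>
      sigma_sets (space M) (\<Union>i\<in>{Draw n}. source_events M R \<epsilon> P \<B> X i)"
    using draw_source[of n] by (intro sigma_sets_mono') blast
  moreover have "?I \<inter> {Draw n} = {}" by auto
  from indep_collect_sources[OF this]
  have "indep_set (sigma_sets (space M) (\<Union>i\<in>?I. source_events M R \<epsilon> P \<B> X i))
    (sigma_sets (space M) (\<Union>i\<in>{Draw n}. source_events M R \<epsilon> P \<B> X i))" .
  ultimately show ?thesis unfolding indep_sets2_eq by blast
qed

text \<open>An intersection-stable family generating the clock up to time \<open>s\<close>. The
  empty set is added because two cylinders may prescribe contradictory counts.\<close>

definition past_cylinders :: "real \<Rightarrow> 'w set set" where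
  "past_cylinders s = insert {} {{\<omega> \<in> space M. \<forall>r\<in>T. num_events P \<epsilon> r \<omega> = a r} | T a.
     finite T \<and> T \<subseteq> {\<epsilon>..s}}"

lemma Int_stable_past_cylinders: "Int_stable (past_cylinders s)"
proof (rule Int_stableI)
  fix A B assume "A \<in> past_cylinders s" "B \<in> past_cylinders s"
  show "A \<inter> B \<in> past_cylinders s"
  proof (cases "A \<inter> B = {}")
    case False
    then obtain T a T' a' where A: "A = {\<omega> \<in> space M. \<forall>r\<in>T. num_events P \<epsilon> r \<omega> = a r}"
      "finite T" "T \<subseteq> {\<epsilon>..s}" and B: "B = {\<omega> \<in> space M. \<forall>r\<in>T'. num_events P \<epsilon> r \<omega> = a' r}"
      "finite T'" "T' \<subseteq> {\<epsilon>..s}"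
      using \<open>A \<in> _\<close> \<open>B \<in> _\<close> unfolding past_cylinders_def by auto
    obtain \<omega>' where "\<omega>' \<in> A" "\<omega>' \<in> B" using False by auto
    then have "A \<inter> B = {\<omega> \<in> space M. \<forall>r\<in>T \<union> T'. num_events P \<epsilon> r \<omega> = num_events P \<epsilon> r \<omega>'}"
      unfolding A B by auto
    moreover have "finite (T \<union> T')" "T \<union> T' \<subseteq> {\<epsilon>..s}" using A B by auto
    ultimately show ?thesis
      unfolding past_cylinders_def
      by (intro insertI2 CollectI exI[of _ "T \<union> T'"] exI[of _ "\<lambda>r. num_events P \<epsilon> r \<omega>'"] conjI)
  qed (simp add: past_cylinders_def)
qed

lemma past_cylinders_clock:
  assumes "A \<in> past_cylinders s" "s \<le> 1"
  shows "A \<in> source_events M R \<epsilon> P \<B> X Clock"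
proof -
  interpret C: sigma_algebra "space M" "source_events M R \<epsilon> P \<B> X Clock"
    by (simp del: mem_Collect_eq, rule sigma_algebra_sigma_sets) auto
  consider "A = {}" | T a where "A = {\<omega> \<in> space M. \<forall>r\<in>T. num_events P \<epsilon> r \<omega> = a r}"
      "finite T" "T \<subseteq> {\<epsilon>..s}"
    using assms(1) unfolding past_cylinders_def by auto
  then show ?thesis
  proof cases
    case 1
    show ?thesis unfolding 1 by (rule C.empty_sets)
  next
    case 2
    have "A = space M \<inter> (\<Inter>r\<in>T. {\<omega> \<in> space M. num_events P \<epsilon> r \<omega> = a r})"
      unfolding 2 by auto
    also have "\<dots> \<in> source_events M R \<epsilon> P \<B> X Clock"
    proof (cases "T = {}")
      case True
      then show ?thesis using C.top by simp
    next
      case False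
      then show ?thesis
        using 2 assms(2) by (intro C.Int C.top C.finite_INT clock_source) auto
    qed
    finally show ?thesis .
  qed
qed

text \<open>Counts at finitely many times up to \<open>s\<close> amount to the increments between
  them, and the Poisson property makes these independent of the increment over
  \<open>(s, t]\<close>.\<close>

lemma past_cylinders_indep:
  assumes A: "A \<in> past_cylinders s" and s: "\<epsilon> \<le> s" "s \<le> t" "t \<le> 1"
  shows "prob (A \<inter> {\<omega> \<in> space M. num_events P s t \<omega> = m}) =
    prob A * prob {\<omega> \<in> space M. num_events P s t \<omega> = m}"
proof (cases "A = {}")
  case False
  then obtain T a where T: "A = {\<omega> \<in> space M. \<forall>r\<in>T. num_events P \<epsilon> r \<omega> = a r}"
      "finite T" "T \<subseteq> {\<epsilon>..s}"
    using A unfolding past_cylinders_def by auto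
  from False obtain \<omega>' where \<omega>': "\<omega>' \<in> A" by auto
  define xs where "xs = sorted_list_of_set (insert \<epsilon> T)"
  have xs: "sorted xs" "set xs = insert \<epsilon> T" using T by (simp_all add: xs_def del: sorted_list_of_set_insert_remove)
  define q where "q = length xs - 1"
  have len: "length xs = Suc q" using xs(2) by (cases xs) (auto simp: q_def)
  have nth_T: "xs ! j \<in> insert \<epsilon> T" if "j \<le> q" for j
    using that len nth_mem[of j xs] xs(2) by auto
  have xs0: "xs ! 0 = \<epsilon>"
  proof -
    obtain i where "i < length xs" "xs ! i = \<epsilon>" using xs(2) by (metis in_set_conv_nth insertI1)
    then have "xs ! 0 \<le> \<epsilon>" using sorted_nth_mono[OF xs(1), of 0 i] by auto
    moreover have "\<epsilon> \<le> xs ! 0" using nth_T[of 0] T(3) by auto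
    ultimately show ?thesis by simp
  qed
  \<comment> \<open>The sorted times, followed by \<open>s\<close> and \<open>t\<close>. Increments
    \<open>0\<close> to \<open>q - 1\<close> determine \<open>A\<close>, number \<open>q\<close>
    leads from the last time to \<open>s\<close> and is left free, number \<open>Suc q\<close> is
    the one over \<open>(s, t]\<close>.\<close>
  define c where "c j = (if j \<le> q then xs ! j else if j = Suc q then s else t)" for j
  have c_mono: "c j \<le> c (Suc j)" for j
  proof -
    consider "j < q" | "j = q" | "j = Suc q" | "j > Suc q" by linarith
    then show ?thesis
    proof cases
      case 1
      then show ?thesis using sorted_nth_mono[OF xs(1), of j "Suc j"] len by (simp add: c_def)
    next
      case 2
      then show ?thesis using nth_T[of q] T(3) s by (auto simp: c_def)
    qed (use s in \<open>auto simp: c_def\<close>)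
  qed
  have c_range: "c j \<in> {\<epsilon>..1}" for j
    using nth_T[of j] subsetD[OF T(3), of "xs ! j"] s by (auto simp: c_def)
  have indep: "indep_vars (\<lambda>_. count_space UNIV)
      (\<lambda>j. num_events P (c j) (c (Suc j))) {..<Suc (Suc q)}"
    using poisson c_mono c_range unfolding poisson_process_def by blast
  let ?I = "\<lambda>j. num_events P (c j) (c (Suc j))"
  \<comment> \<open>\<open>A\<close> is nonempty, so the increments that it prescribes can be read
    off its point \<open>\<omega>'\<close>.\<close>
  define D where "D j = (if j = Suc q then {m} else {?I j \<omega>'})" for j
  define V where "V j = ?I j -` D j \<inter> space M" for j
  have F: "{\<omega> \<in> space M. num_events P s t \<omega> = m} = V (Suc q)"
    by (auto simp: V_def D_def c_def)
  have A_eq: "A = space M \<inter> (\<Inter>j<q. V j)"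
  proof (rule set_eqI)
    fix \<omega>
    have *: "num_events P \<epsilon> (xs ! Suc j) \<omega> = num_events P \<epsilon> (xs ! j) \<omega> + ?I j \<omega>"
      if "\<omega> \<in> space M" "j < q" for j \<omega>
    proof -
      have "\<epsilon> \<le> c j" "c j \<le> c (Suc j)" using c_range[of j] c_mono by auto
      from num_events_add[OF that(1) this] that(2) show ?thesis by (simp add: c_def)
    qed
    have \<omega>'M: "\<omega>' \<in> space M" using \<omega>' T by auto
    show "\<omega> \<in> A \<longleftrightarrow> \<omega> \<in> space M \<inter> (\<Inter>j<q. V j)"
    proof
      assume \<omega>: "\<omega> \<in> A"
      then have \<omega>M: "\<omega> \<in> space M" using T by auto
      have eq: "num_events P \<epsilon> r \<omega> = num_events P \<epsilon> r \<omega>'" if "r \<in> insert \<epsilon> T" for r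
        using that \<omega> \<omega>' unfolding T by (auto simp: num_events_eq_0)
      have "?I j \<omega> = ?I j \<omega>'" if "j < q" for j
        using *[OF \<omega>M that] *[OF \<omega>'M that] eq[OF nth_T, of j] eq[OF nth_T, of "Suc j"] that by simp
      then show "\<omega> \<in> space M \<inter> (\<Inter>j<q. V j)"
        using \<omega>M by (auto simp: V_def D_def)
    next
      assume \<omega>: "\<omega> \<in> space M \<inter> (\<Inter>j<q. V j)"
      have "num_events P \<epsilon> (xs ! j) \<omega> = num_events P \<epsilon> (xs ! j) \<omega>'" if "j \<le> q" for j
        using that
      proof (induction j)
        case 0
        then show ?case by (simp add: xs0 num_events_eq_0)
      next
        case (Suc j)
        then have "\<omega> \<in> V j" using \<omega> by simp
        then have "?I j \<omega> = ?I j \<omega>'" using Suc.prems by (simp add: V_def D_def)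
        then show ?case using Suc *[of \<omega> j] *[of \<omega>' j] \<omega> \<omega>'M by simp
      qed
      moreover have "\<exists>j\<le>q. r = xs ! j" if "r \<in> T" for r
        using that xs(2) len by (metis in_set_conv_nth insertI2 less_Suc_eq_le)
      ultimately have "num_events P \<epsilon> r \<omega> = num_events P \<epsilon> r \<omega>'" if "r \<in> T" for r
        using that by blast
      then show "\<omega> \<in> A" using \<omega> \<omega>' unfolding T by auto
    qed
  qed
  have prob_Int: "prob (\<Inter>j\<in>J. V j) = (\<Prod>j\<in>J. prob (V j))" if "J \<noteq> {}" "J \<subseteq> {..<Suc (Suc q)}" for J
    unfolding V_def using that
    by (intro indep_varsD[OF indep]) (auto intro: finite_subset)
  have "prob A = (\<Prod>j<q. prob (V j))"
  \<comment> \<open>For \<open>q = 0\<close> no increment is prescribed and \<open>A\<close> is the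
    whole space; \<open>prob_Int\<close> needs a nonempty index set.\<close>
  proof (cases "q = 0")
    case True
    then show ?thesis using A_eq prob_space by simp
  next
    case False
    have "A = (\<Inter>j\<in>{..<q}. V j)" using False unfolding A_eq V_def by auto
    moreover have "{..<q} \<noteq> {}" "{..<q} \<subseteq> {..<Suc (Suc q)}" using False by auto
    ultimately show ?thesis using prob_Int by metis
  qed
  moreover have "A \<inter> V (Suc q) = (\<Inter>j\<in>insert (Suc q) {..<q}. V j)"
    unfolding A_eq V_def by auto
  then have "prob (A \<inter> V (Suc q)) = prob (V (Suc q)) * (\<Prod>j<q. prob (V j))"
    using prob_Int[of "insert (Suc q) {..<q}"] by auto
  ultimately show ?thesis unfolding F by simp
qed simp

text \<open>
  The draws are independent of the whole clock, so it suffices to prove independence of the past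
  and the future of the clock, which need only be done for finitely many times.
\<close>
lemma filt_indep:
  assumes E: "E \<in> sets (filt s n)" and s: "\<epsilon> \<le> s" "s \<le> t" "t \<le> 1"
  shows "prob (E \<inter> {\<omega> \<in> space M. num_events P s t \<omega> = m}) =
    prob E * prob {\<omega> \<in> space M. num_events P s t \<omega> = m}"
proof -
  let ?F = "{\<omega> \<in> space M. num_events P s t \<omega> = m}"
  let ?S = "source_events M R \<epsilon> P \<B> X"
  define G where "G = sigma_sets (space M) (\<Union>i\<in>insert Ties (range Draw). ?S i)"
  interpret G: sigma_algebra "space M" G
    unfolding G_def using source_events_subset sets.sets_into_space
    by (intro sigma_algebra_sigma_sets) blast
  have clock: "?S Clock \<subseteq> sigma_sets (space M) (\<Union>i\<in>{Clock}. ?S i)" by (auto intro: sigma_sets.Basic)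
  have "insert Ties (range Draw) \<inter> {Clock} = {}" by auto
  from indep_collect_sources[OF this]
  have indep: "indep_set G (?S Clock)" using clock unfolding G_def indep_sets2_eq by blast
  then have G: "G \<subseteq> events" and GC: "\<And>g c. g \<in> G \<Longrightarrow> c \<in> ?S Clock \<Longrightarrow> prob (g \<inter> c) = prob g * prob c"
    unfolding indep_sets2_eq by auto
  have F: "?F \<in> ?S Clock" using s by (intro clock_source) auto
  have s1: "s \<le> 1" using s by simp
  \<comment> \<open>A pi-system containing the generators of \<open>filt s n\<close>. On it
    independence follows by splitting \<open>g\<close> off from the clock event and then
    \<open>c\<close> off from \<open>?F\<close>.\<close>
  define \<C> where "\<C> = {g \<inter> c | g c. g \<in> G \<and> c \<in> past_cylinders s}"
  have \<C>_events: "\<C> \<subseteq> events"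
    using G past_cylinders_clock[OF _ s1] source_events_subset[of Clock] unfolding \<C>_def by blast
  have stable: "Int_stable \<C>"
  proof (rule Int_stableI)
    fix A B assume "A \<in> \<C>" "B \<in> \<C>"
    then obtain g c g' c' where *: "A = g \<inter> c" "B = g' \<inter> c'" "g \<in> G" "g' \<in> G"
      "c \<in> past_cylinders s" "c' \<in> past_cylinders s"
      unfolding \<C>_def by auto
    have "A \<inter> B = (g \<inter> g') \<inter> (c \<inter> c')" using * by auto
    moreover have "g \<inter> g' \<in> G" using * by auto
    moreover have "c \<inter> c' \<in> past_cylinders s"
      using Int_stableD[OF Int_stable_past_cylinders] * by auto
    ultimately show "A \<inter> B \<in> \<C>" unfolding \<C>_def by blast
  qed
  have "indep_set \<C> {?F}"
  proof (rule indep_setI)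
    show "{?F} \<subseteq> events" using F source_events_subset[of Clock] by blast
    fix a b assume "a \<in> \<C>" "b \<in> {?F}"
    then obtain g c where *: "a = g \<inter> c" "g \<in> G" "c \<in> past_cylinders s" "b = ?F"
      unfolding \<C>_def by auto
    have c: "c \<in> ?S Clock" using past_cylinders_clock[OF *(3) s1] .
    have cF: "c \<inter> ?F \<in> ?S Clock"
      using c F Int_stableD[OF Int_stable_source_events[of Clock]] by blast
    have "prob (a \<inter> b) = prob (g \<inter> (c \<inter> ?F))" using * by (simp add: Int_assoc)
    also have "\<dots> = prob g * (prob c * prob ?F)"
      using GC[OF *(2) cF] past_cylinders_indep[OF *(3) s] by simp
    also have "\<dots> = prob a * prob b" using GC[OF *(2) c] * by simp
    finally show "prob (a \<inter> b) = prob a * prob b" .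
  qed (rule \<C>_events)
  then have "indep_set (sigma_sets (space M) \<C>) (sigma_sets (space M) {?F})"
    using stable by (rule indep_set_sigma_sets) (auto simp: Int_stable_def)
  moreover have "filt_events s n \<subseteq> \<C>"
  proof
    fix A assume A: "A \<in> filt_events s n"
    have spc: "space M \<in> past_cylinders s" unfolding past_cylinders_def by (force intro: exI[of _ "{}"])
    consider "A \<in> sets R" | i where "A \<in> draw_events M \<B> X i"
      | r j where "A = {\<omega> \<in> space M. num_events P \<epsilon> r \<omega> = j}" "\<epsilon> \<le> r" "r \<le> s"
      using A unfolding filt_events_def by auto
    then show "A \<in> \<C>"
    proof cases
      case 1
      then have "A \<in> G" unfolding G_def by (intro sigma_sets.Basic) auto
      then have "A \<in> G" "A = A \<inter> space M" using G.sets_into_space by auto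
      then show ?thesis using spc unfolding \<C>_def by blast
    next
      case 2
      then have "A \<in> G" unfolding G_def using draw_source[of i] by (intro sigma_sets.Basic) blast
      then have "A \<in> G" "A = A \<inter> space M" using G.sets_into_space by auto
      then show ?thesis using spc unfolding \<C>_def by blast
    next
      case 3
      have "A = {\<omega> \<in> space M. \<forall>r'\<in>{r}. num_events P \<epsilon> r' \<omega> = j}" "finite {r}" "{r} \<subseteq> {\<epsilon>..s}"
        using 3 by auto
      then have "A \<in> past_cylinders s" unfolding past_cylinders_def
        by (intro insertI2 CollectI exI[of _ "{r}"] exI[of _ "\<lambda>_. j"]) auto
      moreover have "A = space M \<inter> A" using 3 by auto
      ultimately show ?thesis using G.top unfolding \<C>_def by blast
    qed
  qed
  then have "E \<in> sigma_sets (space M) \<C>"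
    using E sigma_sets_mono'[of "filt_events s n" \<C> "space M"] unfolding sets_filt by auto
  ultimately show ?thesis unfolding indep_sets2_eq by auto
qed

end

section \<open>Increments of the process\<close>

context gs_poisson_matroid
begin

lemma integral_rate:
  assumes "\<epsilon> \<le> s" "s \<le> t"
  shows "(LBINT u:{s..t}. k / u) = k * ln (t / s)"
proof -
  have pos: "0 < s" "0 < t" using assms \<epsilon>_pos by auto
  have cont: "continuous_on {s..t} (\<lambda>u. k / u)"
    using pos by (intro continuous_intros) auto
  have "((\<lambda>u. k / u) has_integral (k * ln t - k * ln s)) {s..t}"
    using assms pos
    by (intro fundamental_theorem_of_calculus)
       (auto intro!: derivative_eq_intros simp flip: has_real_derivative_iff_has_vector_derivative)
  then have "integral {s..t} (\<lambda>u. k / u) = k * ln (t / s)"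
    using pos by (simp add: integral_unique ln_div algebra_simps)
  then show ?thesis
    using set_borel_integral_eq_integral(2)[OF borel_integrable_atLeastAtMost'[OF cont]] by simp
qed

lemma prob_num_events:
  assumes "\<epsilon> \<le> s" "s \<le> t" "t \<le> 1"
  shows "prob {\<omega> \<in> space M. num_events P s t \<omega> = m} =
    (k * ln (t / s)) ^ m / fact m * exp (- (k * ln (t / s)))"
  using poisson assms integral_rate[OF assms(1,2)] unfolding poisson_process_def by auto

text \<open>Meant for \<open>t < 1\<close>: at \<open>t = 1\<close> the count would include an event
  at time exactly 1, which the process does not handle.\<close>

definition state :: "real \<Rightarrow> 'w \<Rightarrow> 'a set" where
  "state t \<omega> = gs_state A\<^sub>0 X h (num_events P \<epsilon> t \<omega>) \<omega>"

text \<open>Both the count and the base are fixed because the next draw \<open>X n B\<close> is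
  indexed by both.\<close>

definition state_event :: "real \<Rightarrow> nat \<Rightarrow> 'a set \<Rightarrow> 'w set" where
  "state_event t n B = {\<omega> \<in> space M. num_events P \<epsilon> t \<omega> = n \<and> gs_state A\<^sub>0 X h n \<omega> = B}"

lemma state_base: "\<omega> \<in> space M \<Longrightarrow> t < 1 \<Longrightarrow> state t \<omega> \<in> \<B>"
  unfolding state_def by (intro gs_state_base num_events_le_card)

lemma state_event_filt:
  assumes "\<epsilon> \<le> t" "t < 1"
  shows "state_event t n B \<in> sets (filt t n)"
proof -
  have "state_event t n B = {\<omega> \<in> space M. n \<le> num_events P \<epsilon> t \<omega> \<and> gs_state A\<^sub>0 X h n \<omega> = B} \<inter>
      {\<omega> \<in> space M. num_events P \<epsilon> t \<omega> = n}"
    by (auto simp: state_event_def)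
  also have "\<dots> \<in> sets (filt t n)"
    using assms by (intro sets.Int gs_state_filt num_events_filt_sets) auto
  finally show ?thesis .
qed

lemma state_measurable:
  assumes "\<epsilon> \<le> t" "t < 1"
  shows "state t \<in> measurable M (count_space \<B>)"
proof -
  have "state t -` {B} \<inter> space M \<in> events" for B
  proof -
    have "state t -` {B} \<inter> space M = (\<Union>n. state_event t n B)"
      by (auto simp: state_event_def state_def)
    also have "\<dots> \<in> events"
      using state_event_filt[OF assms] filt_subset_events[of t] assms by (intro sets.countable_UN) auto
    finally show ?thesis .
  qed
  then show ?thesis
    unfolding measurable_count_space_eq2[OF finite_bases] using state_base[OF _ assms(2)] by auto
qed

lemma integrable_state:
  assumes "\<epsilon> \<le> t" "t < 1"
  shows "integrable M (\<lambda>\<omega>. \<phi> (state t \<omega>) :: real)"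
proof (rule integrable_const_bound)
  show "(\<lambda>\<omega>. \<phi> (state t \<omega>)) \<in> borel_measurable M"
    by (rule measurable_compose[OF state_measurable[OF assms]]) simp
  show "AE \<omega> in M. norm (\<phi> (state t \<omega>)) \<le> (\<Sum>B\<in>\<B>. \<bar>\<phi> B\<bar>)"
    using state_base[OF _ assms(2)] finite_bases
    by (intro AE_I2) (simp add: member_le_sum[of _ _ "\<lambda>B. \<bar>\<phi> B\<bar>"])
qed

text \<open>Divided by the rank, the right-hand side will be the mean over the draw. The inequality
  holds for each outcome, although \<open>h n \<omega>\<close> may depend on the event time. The
  only event in \<open>(s, t]\<close> has number \<open>n\<close>, counted from 0.\<close>

lemma jump_bound:
  assumes \<omega>: "\<omega> \<in> state_event s n B" "num_events P s t \<omega> = 1"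
    and B: "B \<in> \<B>" and V: "V \<in> \<B>" and s: "\<epsilon> \<le> s" "s \<le> t" "t < 1"
  shows "(k - t) * ray U f B s + s * f V - t * ray_slope U f B s \<le>
    (\<Sum>i\<in>B. ray U f (insert (h n \<omega> i) (B - {i})) t)"
proof -
  have \<omega>M: "\<omega> \<in> space M" and n: "num_events P \<epsilon> s \<omega> = n" and st: "gs_state A\<^sub>0 X h n \<omega> = B"
    using \<omega> by (auto simp: state_event_def)
  have nt: "num_events P \<epsilon> t \<omega> = Suc n"
    using num_events_add[OF \<omega>M s(1,2)] n \<omega> by simp
  define \<tau> where "\<tau> = event_time 1 P n \<omega>"
  have lt: "n < card (events_before 1 P \<omega>)"
    using num_events_le_card[OF \<omega>M s(3)] nt by simp
  have \<tau>: "s \<le> \<tau>" "\<tau> \<le> t"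
    using event_time_le_iff[OF \<omega>M, of s n] event_time_le_iff[OF \<omega>M s(3), of n] n nt s
    by (auto simp: \<tau>_def)
  have max: "is_arg_max (\<lambda>B'. \<Sum>i\<in>B'. partial_deriv (multilinear_ext U f) i (\<lambda>j. \<tau> * indicator B j))
      (\<lambda>B. B \<in> \<B>) (Z n \<omega>)"
    using base_maximizes[OF \<omega>M lt] by (simp add: \<tau>_def st)
  then have ZB: "Z n \<omega> \<in> \<B>" by (simp add: is_arg_max_def)
  have "(\<Sum>i\<in>C. partial_deriv (multilinear_ext U f) i (\<lambda>j. \<tau> * indicator B j)) =
      (\<Sum>i\<in>C. marginal_ext U f i (\<lambda>j. \<tau> * indicator B j))" if "C \<in> \<B>" for C
    using bases_subset_ground[OF that] finite_ground
    by (intro sum.cong) (auto simp: partial_deriv_multilinear_ext)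
  then have max': "(\<Sum>i\<in>V. marginal_ext U f i (\<lambda>j. \<tau> * indicator B j)) \<le>
      (\<Sum>i\<in>Z n \<omega>. marginal_ext U f i (\<lambda>j. \<tau> * indicator B j))"
    using max V ZB by (auto simp: is_arg_max_linorder)
  have "(card B - t) * ray U f B s + s * f V - t * ray_slope U f B s \<le>
    (\<Sum>i\<in>B. ray U f (insert (h n \<omega> i) (B - {i})) t)"
  proof (rule sum_ray_exchange_interval[OF _ _ _ _ _ _ max'])
    show "bij_betw (h n \<omega>) B (Z n \<omega>)" using bij[OF \<omega>M lt] st by simp
    show "h n \<omega> i \<notin> B - {i}" if "i \<in> B" for i
      using base_exchange_notin[OF B that] exchange[OF \<omega>M lt] that st by simp
    show "1 \<le> card B" using card_base[OF B] rank_pos by simp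
  qed (use B V ZB bases_subset_ground \<tau> s \<epsilon>_pos in auto)
  then show ?thesis by (simp add: card_base[OF B])
qed

text \<open>\<open>u\<close> is determined by ties, clock and earlier draws, hence independent of
  draw \<open>n\<close>, which hits each element of \<open>B\<close> with probability
  \<open>1 / k\<close>.\<close>

lemma integral_draw:
  assumes u: "u \<in> borel_measurable (filt 1 n)" "\<And>\<omega>. \<omega> \<in> space M \<Longrightarrow> \<bar>u \<omega>\<bar> \<le> (D::real)"
    and B: "B \<in> \<B>" "i \<in> B"
  shows "integrable M (\<lambda>\<omega>. u \<omega> * indicator {\<omega> \<in> space M. X n B \<omega> = i} \<omega>)"
    and "(\<integral>\<omega>. u \<omega> * indicator {\<omega> \<in> space M. X n B \<omega> = i} \<omega> \<partial>M) = (\<integral>\<omega>. u \<omega> \<partial>M) / k"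
proof -
  let ?W = "{\<omega> \<in> space M. X n B \<omega> = i}"
  have W_draw: "?W \<in> draw_events M \<B> X n" using B by (auto simp: draw_events_def)
  then have W: "?W \<in> events"
    using draw_source[of n] source_events_subset[of "Draw n"] by blast
  have filt_M: "sets (filt 1 n) \<subseteq> sets M" by (rule filt_subset_events) simp
  have uM: "u \<in> borel_measurable M"
    using measurable_mono[OF order_refl refl filt_M] u(1) by auto
  have int_u: "integrable M u"
    using u(2) by (intro integrable_const_bound[where B = D] uM AE_I2) auto
  have int_W: "integrable M (indicator ?W :: 'w \<Rightarrow> real)" using W by (simp add: emeasure_eq_measure)
  have "indep_var borel u borel (indicator ?W :: 'w \<Rightarrow> real)"
    unfolding indep_var_eq
  proof (intro conjI uM borel_measurable_indicator W)
    have "sigma_sets (space M) {u -` A \<inter> space M |A. A \<in> sets borel} \<subseteq> sets (filt 1 n)"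
      using measurable_sets[OF u(1)]
      by (intro sets.sigma_sets_subset[of _ "filt 1 n", unfolded space_filt]) auto
    moreover have "sigma_sets (space M) {indicat_real ?W -` A \<inter> space M |A. A \<in> sets borel} \<subseteq>
        sigma_sets (space M) (draw_events M \<B> X n)"
    proof (rule sigma_sets_mono, safe)
      fix A :: "real set"
      interpret D: sigma_algebra "space M" "sigma_sets (space M) (draw_events M \<B> X n)"
        by (rule sigma_algebra_sigma_sets) (auto simp: draw_events_def)
      have "indicat_real ?W -` A \<inter> space M =
          (if 1 \<in> A then ?W else {}) \<union> (if 0 \<in> A then space M - ?W else {})"
        by (auto simp: indicator_def of_bool_def split: if_splits)
      then show "indicat_real ?W -` A \<inter> space M \<in> sigma_sets (space M) (draw_events M \<B> X n)"
        using sigma_sets.Basic[OF W_draw, of "space M"] by auto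
    qed
    ultimately show "indep_set (sigma_sets (space M) {u -` A \<inter> space M |A. A \<in> sets borel})
        (sigma_sets (space M) {indicat_real ?W -` A \<inter> space M |A. A \<in> sets borel})"
      using indep_draw[of n] unfolding indep_sets2_eq by blast
  qed
  from indep_var_lebesgue_integral[OF this int_u int_W] indep_var_integrable[OF this int_u int_W]
  show "integrable M (\<lambda>\<omega>. u \<omega> * indicator ?W \<omega>)"
    "(\<integral>\<omega>. u \<omega> * indicator ?W \<omega> \<partial>M) = (\<integral>\<omega>. u \<omega> \<partial>M) / k"
    using draw_uniform[OF B, of n] card_base[OF B(1)] W by simp_all
qed

text \<open>If there are several events in \<open>(s, t]\<close>, the value at \<open>t\<close> is just bounded below by \<open>0\<close>.\<close>
lemma integral_state_event:
  assumes B: "B \<in> \<B>" and V: "V \<in> \<B>" and s: "\<epsilon> \<le> s" "s \<le> t" "t < 1"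
  defines "\<Lambda> \<equiv> k * ln (t / s)"
  shows "prob (state_event s n B) * (exp (- \<Lambda>) * ray U f B t + \<Lambda> * exp (- \<Lambda>) *
      ((1 - t / k) * ray U f B s + (s / k) * f V - (t / k) * ray_slope U f B s)) \<le>
    (\<integral>\<omega>. indicator (state_event s n B) \<omega> * ray U f (state t \<omega>) t \<partial>M)"
proof -
  let ?E = "state_event s n B"
  define D where "D m = {\<omega> \<in> space M. num_events P s t \<omega> = m}" for m
  define W where "W i = {\<omega> \<in> space M. X n B \<omega> = i}" for i
  \<comment> \<open>The value at \<open>t\<close> if \<open>i\<close> is the element drawn. It does
    not look at the draw, which enters through \<open>W i\<close>.\<close>
  define u where "u i \<omega> = indicator (?E \<inter> D 1) \<omega> * ray U f (insert (h n \<omega> i) (B - {i})) t" for i \<omega>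
  define c where "c = (k - t) * ray U f B s + s * f V - t * ray_slope U f B s"
  have t0: "0 \<le> t" "t \<le> 1" "0 < s" "s \<le> 1" using s \<epsilon>_pos by auto
  have E: "?E \<in> sets (filt s n)" using s by (intro state_event_filt) auto
  have E_events: "?E \<in> events" using E filt_subset_events[of s n] t0 by auto
  have D_events: "D m \<in> events" for m
    using clock_source[of s t m] source_events_subset[of Clock] s unfolding D_def by auto
  have prob_ED: "prob (?E \<inter> D m) = prob ?E * (\<Lambda> ^ m / fact m * exp (- \<Lambda>))" for m
    using filt_indep[OF E s(1,2), of m] prob_num_events[OF s(1,2), of m] t0 unfolding D_def \<Lambda>_def by simp
  have num_t: "num_events P \<epsilon> t \<omega> = n + num_events P s t \<omega>" if "\<omega> \<in> ?E" for \<omega>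
    using that num_events_add[OF _ s(1,2)] by (auto simp: state_event_def)
  \<comment> \<open>The event reaches beyond time \<open>s\<close>, but \<open>filt 1 n\<close>
    holds the whole clock.\<close>
  have ED1: "?E \<inter> D 1 \<in> sets (filt 1 n)"
  proof -
    have "?E \<inter> D 1 = ?E \<inter> {\<omega> \<in> space M. num_events P \<epsilon> t \<omega> = Suc n}"
      using num_t by (auto simp: D_def state_event_def)
    also have "\<dots> \<in> sets (filt 1 n)"
      using E filt_mono[of s 1 n n] t0 s by (intro sets.Int num_events_filt_sets) auto
    finally show ?thesis .
  qed
  have u_meas: "u i \<in> borel_measurable (filt 1 n)" if "i \<in> B" for i
  proof -
    have "i \<in> U" using that B bases_subset_ground by auto
    from bij_measurable[OF this, of n] have "(\<lambda>\<omega>. h n \<omega> i) \<in> measurable (filt 1 n) (count_space UNIV)"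
      using measurable_mono[OF order_refl refl history_subset_filt] by auto
    from measurable_compose[OF this, of "\<lambda>j. ray U f (insert j (B - {i})) t" borel] ED1
    show ?thesis unfolding u_def by (intro borel_measurable_times borel_measurable_indicator) auto
  qed
  have u_bound: "0 \<le> u i \<omega>" "u i \<omega> \<le> f U" for i \<omega>
    using ray_bounds[OF t0(1,2)] top_nonneg by (auto simp: u_def indicator_def)
  have uW: "integrable M (\<lambda>\<omega>. u i \<omega> * indicator (W i) \<omega>)"
    "(\<integral>\<omega>. u i \<omega> * indicator (W i) \<omega> \<partial>M) = (\<integral>\<omega>. u i \<omega> \<partial>M) / k" if "i \<in> B" for i
    unfolding W_def using u_meas[OF that] u_bound that B
    by (intro integral_draw[where D = "f U"]; auto)+
  have int_u: "integrable M (u i)" if "i \<in> B" for i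
  proof (rule integrable_const_bound)
    show "AE \<omega> in M. norm (u i \<omega>) \<le> f U" using u_bound by auto
    show "u i \<in> borel_measurable M"
      using measurable_mono[OF order_refl refl filt_subset_events[of 1 n]] u_meas[OF that] by auto
  qed
  have int_ED: "integrable M (\<lambda>\<omega>. indicator (?E \<inter> D m) \<omega> * (a::real))" for m a
    using E_events D_events by (auto simp: emeasure_eq_measure)
  \<comment> \<open>\<open>jump_bound\<close> is applied for each outcome before averaging; the
    division by \<open>k\<close> in \<open>integral_draw\<close> then turns the sum into the mean
    over the draw.\<close>
  have "prob (?E \<inter> D 1) * c = (\<integral>\<omega>. indicator (?E \<inter> D 1) \<omega> * c \<partial>M)"
    using E_events D_events by simp
  also have "\<dots> \<le> (\<integral>\<omega>. (\<Sum>i\<in>B. u i \<omega>) \<partial>M)"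
  proof (rule integral_mono)
    fix \<omega> assume "\<omega> \<in> space M"
    show "indicator (?E \<inter> D 1) \<omega> * c \<le> (\<Sum>i\<in>B. u i \<omega>)"
    proof (cases "\<omega> \<in> ?E \<inter> D 1")
      case True
      then show ?thesis
        using jump_bound[of \<omega> s n B t V] B V s by (simp add: c_def u_def D_def)
    qed (simp add: u_def)
  qed (use int_ED int_u in auto)
  also have "\<dots> = (\<Sum>i\<in>B. \<integral>\<omega>. u i \<omega> \<partial>M)" using int_u by (rule Bochner_Integration.integral_sum)
  finally have c_le: "prob (?E \<inter> D 1) * c / k \<le> (\<Sum>i\<in>B. \<integral>\<omega>. u i \<omega> \<partial>M) / k"
    by (intro divide_right_mono) auto
  have "prob ?E * (exp (- \<Lambda>) * ray U f B t + \<Lambda> * exp (- \<Lambda>) *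
      ((1 - t / k) * ray U f B s + (s / k) * f V - (t / k) * ray_slope U f B s)) =
      prob (?E \<inter> D 0) * ray U f B t + prob (?E \<inter> D 1) * c / k"
    using rank_pos unfolding prob_ED c_def by (simp add: field_simps)
  also have "\<dots> \<le> prob (?E \<inter> D 0) * ray U f B t + (\<Sum>i\<in>B. (\<integral>\<omega>. u i \<omega> \<partial>M) / k)"
    using c_le by (simp add: sum_divide_distrib)
  also have "\<dots> = (\<integral>\<omega>. indicator (?E \<inter> D 0) \<omega> * ray U f B t \<partial>M) +
      (\<Sum>i\<in>B. \<integral>\<omega>. u i \<omega> * indicator (W i) \<omega> \<partial>M)"
    using E_events D_events uW by simp
  also have "(\<Sum>i\<in>B. \<integral>\<omega>. u i \<omega> * indicator (W i) \<omega> \<partial>M) =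
      (\<integral>\<omega>. (\<Sum>i\<in>B. u i \<omega> * indicator (W i) \<omega>) \<partial>M)"
    using uW(1) by (rule Bochner_Integration.integral_sum[symmetric])
  also have "(\<integral>\<omega>. indicator (?E \<inter> D 0) \<omega> * ray U f B t \<partial>M) +
      (\<integral>\<omega>. (\<Sum>i\<in>B. u i \<omega> * indicator (W i) \<omega>) \<partial>M) =
      (\<integral>\<omega>. indicator (?E \<inter> D 0) \<omega> * ray U f B t + (\<Sum>i\<in>B. u i \<omega> * indicator (W i) \<omega>) \<partial>M)"
    using int_ED uW(1) by (intro Bochner_Integration.integral_add[symmetric] Bochner_Integration.integrable_sum) auto
  also have "\<dots> \<le> (\<integral>\<omega>. indicator ?E \<omega> * ray U f (state t \<omega>) t \<partial>M)"
  proof (rule integral_mono)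
    show "integrable M (\<lambda>\<omega>. indicator (?E \<inter> D 0) \<omega> * ray U f B t + (\<Sum>i\<in>B. u i \<omega> * indicator (W i) \<omega>))"
      using int_ED uW(1) by (intro Bochner_Integration.integrable_add Bochner_Integration.integrable_sum) auto
    show "integrable M (\<lambda>\<omega>. indicator ?E \<omega> * ray U f (state t \<omega>) t)"
      using integrable_real_mult_indicator[OF E_events integrable_state[of t "\<lambda>B. ray U f B t"]] s
      by (simp add: mult.commute)
    fix \<omega> assume \<omega>M: "\<omega> \<in> space M"
    show "indicator (?E \<inter> D 0) \<omega> * ray U f B t + (\<Sum>i\<in>B. u i \<omega> * indicator (W i) \<omega>) \<le>
        indicator ?E \<omega> * ray U f (state t \<omega>) t"
    proof (cases "\<omega> \<in> ?E")
      case True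
      then have st: "gs_state A\<^sub>0 X h n \<omega> = B" by (simp add: state_event_def)
      consider "num_events P s t \<omega> = 0" | "num_events P s t \<omega> = 1" | "num_events P s t \<omega> > 1"
        by linarith
      then show ?thesis
      proof cases
        case 1
        then show ?thesis
          using True \<omega>M st num_t[OF True] by (simp add: u_def D_def state_def)
      next
        case 2
        define i where "i = X n B \<omega>"
        have i: "i \<in> B" unfolding i_def using B base_nonempty \<omega>M by (intro draw_in) auto
        have "(\<Sum>j\<in>B. u j \<omega> * indicator (W j) \<omega>) = (\<Sum>j\<in>B. if j = i then u i \<omega> else 0)"
          using \<omega>M by (intro sum.cong) (auto simp: W_def i_def)
        also have "\<dots> = u i \<omega>" using i base_finite[OF B] by simp
        also have "\<dots> = ray U f (state t \<omega>) t"
          using True \<omega>M 2 num_t[OF True] gs_state_Suc_eq[OF st B]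
          by (simp add: u_def D_def state_def i_def del: gs_state.simps)
        finally show ?thesis using True 2 by (simp add: D_def)
      next
        case 3
        then show ?thesis using True ray_bounds[OF t0(1,2)] by (simp add: u_def D_def)
      qed
    qed (simp add: u_def)
  qed
  finally show ?thesis .
qed

end

section \<open>From short intervals to the output\<close>

context gs_poisson_matroid
begin

definition value_at :: "real \<Rightarrow> real" where
  "value_at t = (\<integral>\<omega>. ray U f (state t \<omega>) t \<partial>M)"

text \<open>The constant of \<open>poisson_step_estimate\<close> for \<open>K = k * f U\<close>,
  \<open>L = k * f U * card U\<close> and \<open>D = f U\<close>, which bound slopes, curvature
  errors and values for all bases at once.\<close>

definition step_error :: real where
  "step_error = k * f U / \<epsilon> + k * f U * card U + (k / \<epsilon>)\<^sup>2 * f U + (k + 1) / \<epsilon> * f U + f U / \<epsilon>"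

text \<open>The events \<open>state_event s n B\<close> partition the space, and on each the
  estimate holds. As \<open>n\<close> is unbounded, they are summed up to count \<open>m\<close>,
  and dominated convergence passes to the limit.\<close>

lemma value_at_step:
  assumes V: "V \<in> \<B>" and s: "\<epsilon> \<le> s" "s \<le> t" "t < 1"
  shows "value_at s + (t - s) * (f V - value_at s) - step_error * (t - s)\<^sup>2 \<le> value_at t"
proof -
  have t0: "0 \<le> t" "t \<le> 1" "0 \<le> s" "s < 1" "s \<le> 1" using s \<epsilon>_pos by auto
  \<comment> \<open>The lower bound wanted when the state at \<open>s\<close> is \<open>B\<close>.
    It is affine in the ray value, so its expectation is the left-hand side of the claim.\<close>
  define v where "v B = ray U f B s + (t - s) * (f V - ray U f B s) - step_error * (t - s)\<^sup>2" for B
  define w where "w \<omega> = ray U f (state t \<omega>) t - v (state s \<omega>)" for \<omega>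
  have int_t: "integrable M (\<lambda>\<omega>. ray U f (state t \<omega>) t)"
    using s integrable_state[of t "\<lambda>B. ray U f B t"] by simp
  have int_s: "integrable M (\<lambda>\<omega>. \<phi> (state s \<omega>))" for \<phi> :: "'a set \<Rightarrow> real"
    using s by (intro integrable_state) auto
  have int_w: "integrable M w" unfolding w_def using int_t int_s by auto
  have E: "state_event s n B \<in> events" for n B
    using state_event_filt[of s n B] filt_subset_events[of s n] s t0 by auto
  have int_E: "integrable M (\<lambda>\<omega>. indicator (state_event s n B) \<omega> * w \<omega>)" for n B
    using integrable_real_mult_indicator[OF E int_w] by (simp add: mult.commute)
  have nonneg_E: "0 \<le> (\<integral>\<omega>. indicator (state_event s n B) \<omega> * w \<omega> \<partial>M)" if B: "B \<in> \<B>" for n B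
  proof -
    let ?E = "state_event s n B"
    have BU: "B \<subseteq> U" using B by (rule bases_subset_ground)
    have "v B \<le> exp (- (k * ln (t / s))) * ray U f B t + k * ln (t / s) * exp (- (k * ln (t / s))) *
        ((1 - t / k) * ray U f B s + (s / k) * f V - (t / k) * ray_slope U f B s)"
      unfolding v_def step_error_def
    proof (rule poisson_step_estimate)
      show "(t - s) * ray_slope U f B s - k * f U * card U * (t - s)\<^sup>2 \<le> ray U f B t - ray U f B s"
        using ray_increment'[OF BU t0(3) s(2) t0(2)] card_base[OF B] by simp
      show "ray_slope U f B s \<le> k * f U"
        using ray_slope_bounds[OF BU, of s] t0 card_base[OF B] by simp
    qed (use BU V bases_subset_ground rank_pos s t0 \<epsilon>_pos ray_bounds ray_slope_bounds nonneg le_top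
        top_nonneg in auto)
    then have "prob ?E * v B \<le> (\<integral>\<omega>. indicator ?E \<omega> * ray U f (state t \<omega>) t \<partial>M)"
      using integral_state_event[OF B V s, of n] measure_nonneg[of M ?E]
      by (meson mult_left_mono order_trans)
    moreover have "(\<integral>\<omega>. indicator ?E \<omega> * w \<omega> \<partial>M) =
        (\<integral>\<omega>. indicator ?E \<omega> * ray U f (state t \<omega>) t - indicator ?E \<omega> * v B \<partial>M)"
      by (intro Bochner_Integration.integral_cong) (auto simp: w_def state_def state_event_def indicator_def)
    moreover have "\<dots> = (\<integral>\<omega>. indicator ?E \<omega> * ray U f (state t \<omega>) t \<partial>M) - prob ?E * v B"
      using E integrable_real_mult_indicator[OF E int_t]
      by (subst Bochner_Integration.integral_diff) (auto simp: mult.commute emeasure_eq_measure)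
    ultimately show ?thesis by simp
  qed
  define A where "A m = {\<omega> \<in> space M. num_events P \<epsilon> s \<omega> \<le> m}" for m
  have A: "A m \<in> events" for m
    using num_events_filt_sets[of s s "\<lambda>i. i \<le> m" 0] filt_subset_events[of s 0] s t0 by (auto simp: A_def)
  have A_eq: "indicator (A m) \<omega> = (\<Sum>n\<le>m. \<Sum>B\<in>\<B>. indicator (state_event s n B) \<omega> :: real)"
    if "\<omega> \<in> space M" for m \<omega>
  proof -
    have "(\<Sum>B\<in>\<B>. indicator (state_event s n B) \<omega> :: real) = (if n = num_events P \<epsilon> s \<omega> then 1 else 0)" for n
    proof -
      have "(\<Sum>B\<in>\<B>. indicator (state_event s n B) \<omega> :: real) =
          (\<Sum>B\<in>\<B>. if B = state s \<omega> then if n = num_events P \<epsilon> s \<omega> then 1 else 0 else 0)"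
        using that by (intro sum.cong) (auto simp: state_event_def state_def indicator_def)
      then show ?thesis using state_base[OF that t0(4)] finite_bases by simp
    qed
    then show ?thesis using that by (simp add: A_def indicator_def)
  qed
  have "0 \<le> (\<integral>\<omega>. indicator (A m) \<omega> * w \<omega> \<partial>M)" for m
  proof -
    have "(\<integral>\<omega>. indicator (A m) \<omega> * w \<omega> \<partial>M) =
        (\<integral>\<omega>. (\<Sum>n\<le>m. \<Sum>B\<in>\<B>. indicator (state_event s n B) \<omega> * w \<omega>) \<partial>M)"
      by (intro Bochner_Integration.integral_cong) (auto simp: A_eq sum_distrib_right)
    also have "\<dots> = (\<Sum>n\<le>m. \<Sum>B\<in>\<B>. \<integral>\<omega>. indicator (state_event s n B) \<omega> * w \<omega> \<partial>M)"
      using int_E by (simp add: Bochner_Integration.integral_sum Bochner_Integration.integrable_sum)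
    also have "\<dots> \<ge> 0" using nonneg_E by (intro sum_nonneg) auto
    finally show ?thesis .
  qed
  moreover have "(\<lambda>m. \<integral>\<omega>. indicator (A m) \<omega> * w \<omega> \<partial>M) \<longlonglongrightarrow> (\<integral>\<omega>. w \<omega> \<partial>M)"
  proof (rule integral_dominated_convergence[where w = "\<lambda>\<omega>. norm (w \<omega>)"])
    show "AE \<omega> in M. (\<lambda>m. indicator (A m) \<omega> * w \<omega>) \<longlonglongrightarrow> w \<omega>"
    proof (rule AE_I2)
      fix \<omega> assume \<omega>: "\<omega> \<in> space M"
      have "eventually (\<lambda>m. indicator (A m) \<omega> * w \<omega> = w \<omega>) sequentially"
        using eventually_ge_at_top[of "num_events P \<epsilon> s \<omega>"]
        by eventually_elim (use \<omega> in \<open>simp add: A_def\<close>)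
      then show "(\<lambda>m. indicator (A m) \<omega> * w \<omega>) \<longlonglongrightarrow> w \<omega>" by (rule tendsto_eventually)
    qed
  qed (use int_w A in \<open>auto simp: indicator_def\<close>)
  ultimately have "0 \<le> (\<integral>\<omega>. w \<omega> \<partial>M)" by (intro LIMSEQ_le_const) auto
  also have "(\<integral>\<omega>. w \<omega> \<partial>M) = value_at t - (\<integral>\<omega>. v (state s \<omega>) \<partial>M)"
    unfolding w_def value_at_def using int_t int_s by simp
  also have "(\<integral>\<omega>. v (state s \<omega>) \<partial>M) =
      value_at s + (t - s) * (f V - value_at s) - step_error * (t - s)\<^sup>2"
    unfolding v_def value_at_def using int_s[of "\<lambda>B. ray U f B s"] by (simp add: prob_space)
  finally show ?thesis by simp
qed

text \<open>The start enters only through \<open>0 \<le> value_at \<epsilon>\<close>, which holds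
  for any initial base.\<close>

lemma value_at_ge:
  assumes "V \<in> \<B>" "\<epsilon> \<le> b" "b < 1"
  shows "(1 - exp (- (b - \<epsilon>))) * f V \<le> value_at b"
proof (rule exp_growth_of_increments[where C = step_error])
  show "value_at s + (t - s) * (f V - value_at s) - step_error * (t - s)\<^sup>2 \<le> value_at t"
    if "\<epsilon> \<le> s" "s < t" "t \<le> b" for s t
    using that assms by (intro value_at_step) auto
  show "0 \<le> value_at \<epsilon>"
    unfolding value_at_def using \<epsilon>_pos \<epsilon>_less ray_bounds by (intro Bochner_Integration.integral_nonneg) auto
  show "0 \<le> f V" using nonneg assms(1) bases_subset_ground by auto
  show "0 \<le> step_error" unfolding step_error_def using top_nonneg \<epsilon>_pos by auto
qed (use assms in auto)

text \<open>Estimates are available only before time 1. As finitely many events come before 1, the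
  state at late enough times equals the output, and dominated convergence transfers the
  bound.\<close>

lemma output_bound:
  assumes V: "V \<in> \<B>"
  shows "integrable M (\<lambda>\<omega>. f (gs_output P A\<^sub>0 X h \<omega>))"
    and "(1 - exp (- (1 - \<epsilon>))) * f V \<le> expectation (\<lambda>\<omega>. f (gs_output P A\<^sub>0 X h \<omega>))"
proof -
  \<comment> \<open>Starts at \<epsilon> and increases to 1 without reaching it.\<close>
  define s where "s m = 1 - (1 - \<epsilon>) * inverse (real (Suc m))" for m
  have s_lim: "s \<longlonglongrightarrow> 1"
    unfolding s_def using tendsto_diff[OF tendsto_const tendsto_mult_right_zero[OF LIMSEQ_inverse_real_of_nat]]
    by simp
  have s: "\<epsilon> \<le> s m" "s m < 1" for m
  proof -
    have "inverse (real (Suc m)) \<le> 1" by (simp add: inverse_eq_divide)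
    then have "(1 - \<epsilon>) * inverse (real (Suc m)) \<le> (1 - \<epsilon>) * 1"
      using \<epsilon>_less by (intro mult_left_mono) auto
    then show "\<epsilon> \<le> s m" by (simp add: s_def)
    show "s m < 1" unfolding s_def using \<epsilon>_less by simp
  qed
  have meas: "(\<lambda>\<omega>. f (state (s m) \<omega>)) \<in> borel_measurable M" for m
    using integrable_state[OF s, of f] by auto
  have lim: "(\<lambda>m. f (state (s m) \<omega>)) \<longlonglongrightarrow> f (gs_output P A\<^sub>0 X h \<omega>)" if \<omega>: "\<omega> \<in> space M" for \<omega>
  proof (rule tendsto_eventually)
    have "finite (events_before 1 P \<omega>)" using finite_P[OF \<omega>] by (simp add: events_before_def)
    moreover have "\<forall>x\<in>events_before 1 P \<omega>. eventually (\<lambda>m. x < s m) sequentially"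
      using order_tendstoD(1)[OF s_lim] by (auto simp: events_before_def)
    ultimately have "eventually (\<lambda>m. \<forall>x\<in>events_before 1 P \<omega>. x < s m) sequentially"
      by (rule eventually_ball_finite)
    then show "eventually (\<lambda>m. f (state (s m) \<omega>) = f (gs_output P A\<^sub>0 X h \<omega>)) sequentially"
    proof eventually_elim
      fix m assume "\<forall>x\<in>events_before 1 P \<omega>. x < s m"
      then have "events_before 1 P \<omega> \<inter> {..s m} = events_before 1 P \<omega>" by auto
      then show "f (state (s m) \<omega>) = f (gs_output P A\<^sub>0 X h \<omega>)"
        using events_before_eq[OF \<omega> s(2), of m] by (simp add: state_def gs_output_def num_events_def)
    qed
  qed
  have bound: "norm (f (state (s m) \<omega>)) \<le> f U" if "\<omega> \<in> space M" for m \<omega>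
    using bases_subset_ground[OF state_base[OF that s(2)]] nonneg le_top by simp
  have out_meas: "(\<lambda>\<omega>. f (gs_output P A\<^sub>0 X h \<omega>)) \<in> borel_measurable M"
    using lim meas by (rule borel_measurable_LIMSEQ_real)
  note dom = out_meas meas integrable_const[of "f U"] AE_I2[OF lim] AE_I2[OF bound]
  show "integrable M (\<lambda>\<omega>. f (gs_output P A\<^sub>0 X h \<omega>))"
    using dom by (rule integrable_dominated_convergence)
  have conv: "(\<lambda>m. expectation (\<lambda>\<omega>. f (state (s m) \<omega>))) \<longlonglongrightarrow> expectation (\<lambda>\<omega>. f (gs_output P A\<^sub>0 X h \<omega>))"
    using dom by (rule integral_dominated_convergence)
  have "(1 - exp (- (s m - \<epsilon>))) * f V \<le> expectation (\<lambda>\<omega>. f (state (s m) \<omega>))" for m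
  proof -
    have "(1 - exp (- (s m - \<epsilon>))) * f V \<le> value_at (s m)" using V s by (intro value_at_ge) auto
    \<comment> \<open>By monotonicity \<open>F(t 1_A)\<close> is at most
      \<open>F(1_A) = f A\<close>.\<close>
    also have "\<dots> \<le> expectation (\<lambda>\<omega>. f (state (s m) \<omega>))"
      unfolding value_at_def
    proof (rule integral_mono)
      fix \<omega> assume "\<omega> \<in> space M"
      then have "state (s m) \<omega> \<subseteq> U" using state_base s bases_subset_ground by auto
      moreover have "0 \<le> s m" using s(1)[of m] \<epsilon>_pos by linarith
      ultimately show "ray U f (state (s m) \<omega>) (s m) \<le> f (state (s m) \<omega>)"
        using ray_mono[of "s m" 1 "state (s m) \<omega>"] ray_one s(2)[of m] by simp
    qed (use integrable_state[OF s] in auto)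
    finally show ?thesis .
  qed
  moreover have "(\<lambda>m. (1 - exp (- (s m - \<epsilon>))) * f V) \<longlonglongrightarrow> (1 - exp (- (1 - \<epsilon>))) * f V"
    by (intro tendsto_intros s_lim)
  ultimately show "(1 - exp (- (1 - \<epsilon>))) * f V \<le> expectation (\<lambda>\<omega>. f (gs_output P A\<^sub>0 X h \<omega>))"
    using conv by (intro LIMSEQ_le) auto
qed

end

text \<open>Convexity of the exponential: on \<open>[0, 1]\<close> the graph of
  \<open>exp (- x)\<close> lies below its chord.\<close>

lemma one_minus_exp_ge:
  fixes x :: real
  assumes "0 \<le> x" "x \<le> 1"
  shows "x * (1 - 1 / exp 1) \<le> 1 - exp (- x)"
proof -
  have "exp ((1 - x) *\<^sub>R 0 + x *\<^sub>R (- 1)) \<le> (1 - x) * exp 0 + x * exp (- 1 :: real)"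
    using assms by (intro convex_onD[OF exp_convex]) auto
  then show ?thesis by (simp add: exp_minus inverse_eq_divide algebra_simps)
qed

theorem theorem1p1:
  fixes U :: "'a set" and \<I> :: "'a set set" and f :: "'a set \<Rightarrow> real"
    and \<epsilon> :: real and Opt :: "'a set"
    and M R :: "'w measure" and P :: "'w \<Rightarrow> real set" and X :: "nat \<Rightarrow> 'a set \<Rightarrow> 'w \<Rightarrow> 'a"
    and A\<^sub>0 :: "'w \<Rightarrow> 'a set" and Z :: "nat \<Rightarrow> 'w \<Rightarrow> 'a set" and h :: "nat \<Rightarrow> 'w \<Rightarrow> 'a \<Rightarrow> 'a"
  assumes "matroid U \<I>"
    and "\<forall>S\<subseteq>U. 0 \<le> f S"
    and "mono_on (Pow U) f"
    and "submodular U f"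
    and "0 < \<epsilon>" and "\<epsilon> \<le> 1"
    and "gs_poisson M U \<I> f \<epsilon> R P X A\<^sub>0 Z h"
    and "is_arg_max f (\<lambda>S. S \<in> \<I>) Opt"
  shows "(\<forall>\<omega>\<in>space M. gs_output P A\<^sub>0 X h \<omega> \<in> \<I>) \<and>
    integrable M (\<lambda>\<omega>. f (gs_output P A\<^sub>0 X h \<omega>)) \<and>
    prob_space.expectation M (\<lambda>\<omega>. f (gs_output P A\<^sub>0 X h \<omega>)) \<ge>
      (1 - \<epsilon>) * (1 - 1 / exp 1) * f Opt"
proof -
  interpret matroid U \<I> by fact
  interpret gs_poisson M U \<I> f \<epsilon> R P X A\<^sub>0 Z h by fact
  interpret monotone_submodular U f
    using assms finite_ground by unfold_locales auto
  have out: "gs_output P A\<^sub>0 X h \<omega> \<in> \<I>" if "\<omega> \<in> space M" for \<omega>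
    unfolding gs_output_def using that by (intro bases_indep gs_state_base) auto
  have Opt: "Opt \<in> \<I>" using assms(8) by (simp add: is_arg_max_def)
  \<comment> \<open>The analysis compares with a base, since \<open>Z n\<close> is maximal among
    bases; by monotonicity, passing from \<open>Opt\<close> to \<open>V\<close> loses no
    value.\<close>
  obtain V where V: "V \<in> matroid_bases \<I>" "Opt \<subseteq> V" using indep_subset_base[OF Opt] .
  consider "\<epsilon> = 1" | "matroid_rank \<I> = 0" | "\<epsilon> < 1" "0 < matroid_rank \<I>" using assms(6) by linarith
  then have "integrable M (\<lambda>\<omega>. f (gs_output P A\<^sub>0 X h \<omega>)) \<and>
    (1 - \<epsilon>) * (1 - 1 / exp 1) * f Opt \<le> expectation (\<lambda>\<omega>. f (gs_output P A\<^sub>0 X h \<omega>))"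
  proof cases
    case 1
    \<comment> \<open>The time interval is empty, so the output is the initial base, and the claimed
      bound is 0.\<close>
    have out_eq: "gs_output P A\<^sub>0 X h \<omega> = A\<^sub>0 \<omega>" if "\<omega> \<in> space M" for \<omega>
    proof -
      have "P \<omega> = {}" using poisson that 1 by (auto simp: poisson_process_def)
      then show ?thesis by (simp add: gs_output_def events_before_def)
    qed
    have A\<^sub>0U: "A\<^sub>0 \<omega> \<subseteq> U" if "\<omega> \<in> space M" for \<omega>
      using bases_subset_ground[OF init_base[OF that]] .
    have "A\<^sub>0 \<in> measurable M (count_space UNIV)"
      using ties init_measurable by (rule measurable_from_subalg)
    then have "integrable M (\<lambda>\<omega>. f (A\<^sub>0 \<omega>))"
      using A\<^sub>0U nonneg le_top
      by (intro integrable_const_bound[where B = "f U"] AE_I2) (auto intro: measurable_compose)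
    then have "integrable M (\<lambda>\<omega>. f (gs_output P A\<^sub>0 X h \<omega>))"
      by (rule Bochner_Integration.integrable_cong[THEN iffD2, rotated 2]) (simp_all add: out_eq)
    moreover have "0 \<le> expectation (\<lambda>\<omega>. f (gs_output P A\<^sub>0 X h \<omega>))"
      using out indep_subset_ground nonneg by (intro Bochner_Integration.integral_nonneg) blast
    ultimately show ?thesis using 1 by simp
  next
    case 2
    \<comment> \<open>The empty set is the only independent set, so the output is
      \<open>Opt\<close>.\<close>
    have "S = {}" if S: "S \<in> \<I>" for S
    proof -
      obtain B where B: "B \<in> matroid_bases \<I>" "S \<subseteq> B" using indep_subset_base[OF S] .
      then have "finite B" using bases_subset_ground finite_ground finite_subset by blast
      then show ?thesis using card_base[OF B(1)] 2 B(2) by auto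
    qed
    then have eq: "gs_output P A\<^sub>0 X h \<omega> = Opt" if "\<omega> \<in> space M" for \<omega>
      using out[OF that] Opt by blast
    have "integrable M (\<lambda>\<omega>. f (gs_output P A\<^sub>0 X h \<omega>)) \<longleftrightarrow> integrable M (\<lambda>\<omega>. f Opt)"
      by (intro Bochner_Integration.integrable_cong) (simp_all add: eq)
    moreover have "expectation (\<lambda>\<omega>. f (gs_output P A\<^sub>0 X h \<omega>)) = expectation (\<lambda>\<omega>. f Opt)"
      by (intro Bochner_Integration.integral_cong) (simp_all add: eq)
    moreover have "(1 - \<epsilon>) * (1 - 1 / exp 1) * f Opt \<le> f Opt"
    proof -
      have "0 \<le> f Opt" using Opt indep_subset_ground nonneg by auto
      moreover have "(1 - \<epsilon>) * (1 - 1 / exp 1) \<le> 1" "0 \<le> (1 - \<epsilon>) * (1 - 1 / exp 1)"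
        using assms(5,6) by (auto intro!: mult_le_one)
      ultimately show ?thesis by (intro mult_left_le_one_le)
    qed
    ultimately show ?thesis by (simp add: prob_space)
  next
    case 3
    interpret gs_poisson_matroid M U \<I> f \<epsilon> R P X A\<^sub>0 Z h
      using 3 assms(5) by unfold_locales auto
    have VU: "V \<subseteq> U" using V bases_subset_ground by auto
    have "(1 - \<epsilon>) * (1 - 1 / exp 1) * f Opt \<le> (1 - exp (- (1 - \<epsilon>))) * f V"
    proof (intro mult_mono one_minus_exp_ge)
      show "f Opt \<le> f V" using VU V(2) by (auto intro!: mono_onD[OF mono])
      show "0 \<le> f Opt" using Opt indep_subset_ground nonneg by auto
    qed (use assms(5,6) in auto)
    then show ?thesis using output_bound[OF V(1)] by simp
  qed
  then show ?thesis using out by simp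
qed

end
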